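(* Let $n\ge1$, $s\in(0,1/n]$, and let $\mu$ be an $s$-concave probability measure on $\mathbb{R}^n$ supported on a convex body $K$. Then $$\operatorname{Var}_\mu(-\log q_\mu)\ \leq\ \frac{\pi^2}{6s^2}.$$ In particular, for the uniform probability measure $\mu_K$ on a convex body $K\subseteq\mathbb{R}^n$, $$\operatorname{Var}_{\mu_K}(-\log q_K)\ \leq\ \frac{\pi^2}{6}\,n^2.$$
   Context: A convex body in $\mathbb{R}^n$ is a compact convex set with non-empty interior. A Borel probability measure $\mu$ on $\mathbb{R}^n$ is $s$-concave, $s\in(0,1/n]$, if it is full-dimensional (i.e. $\mu(H)<1$ for every hyperplane $H$) and $\mu((1-\lambda)A+\lambda B)^s\geq(1-\lambda)\mu(A)^s+\lambda\mu(B)^s$ for all compact sets $A,B\subseteq\mathbb{R}^n$ with $\mu(A)\mu(B)>0$ and all $\lambda\in[0,1]$. "Supported on $K$" means that the support of $\mu$ is $K$. The Tukey half-space depth is $q_\mu(x)=\inf\{\mu(H): H\subseteq\mathbb{R}^n\text{ a closed half-space containing }x\}$, and $q_K=q_{\mu_K}$. $\operatorname{Var}_\mu(f)$ is the variance of $f(X)$ when $X$ has law $\mu$. *)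

theory Defs
  imports "HOL-Probability.Probability"
begin

definition convex_body :: "'a::euclidean_space set \<Rightarrow> bool" where
  "convex_body K \<longleftrightarrow> compact K \<and> convex K \<and> interior K \<noteq> {}"

definition hyperplane :: "'a::euclidean_space set \<Rightarrow> bool" where
  "hyperplane H \<longleftrightarrow> (\<exists>a b. a \<noteq> 0 \<and> H = {x. a \<bullet> x = b})"

definition closed_halfspace :: "'a::euclidean_space set \<Rightarrow> bool" where
  "closed_halfspace H \<longleftrightarrow> (\<exists>a b. a \<noteq> 0 \<and> H = {x. a \<bullet> x \<le> b})"

definition borel_prob :: "'a::euclidean_space measure \<Rightarrow> bool" where
  "borel_prob \<mu> \<longleftrightarrow> prob_space \<mu> \<and> sets \<mu> = sets borel"

definition full_dimensional :: "'a::euclidean_space measure \<Rightarrow> bool" where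
  "full_dimensional \<mu> \<longleftrightarrow> (\<forall>H. hyperplane H \<longrightarrow> measure \<mu> H < 1)"

definition s_concave :: "real \<Rightarrow> 'a::euclidean_space measure \<Rightarrow> bool" where
  "s_concave s \<mu> \<longleftrightarrow>
     borel_prob \<mu> \<and> full_dimensional \<mu> \<and>
     (\<forall>A B. \<forall>t\<in>{0..1}. compact A \<and> compact B \<and> measure \<mu> A * measure \<mu> B > 0 \<longrightarrow>
        measure \<mu> {(1 - t) *\<^sub>R a + t *\<^sub>R b | a b. a \<in> A \<and> b \<in> B} powr s
          \<ge> (1 - t) * measure \<mu> A powr s + t * measure \<mu> B powr s)"

definition measure_support :: "'a::euclidean_space measure \<Rightarrow> 'a set" where
  "measure_support \<mu> = {x. \<forall>U. open U \<and> x \<in> U \<longrightarrow> measure \<mu> U > 0}"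

definition tukey_depth :: "'a::euclidean_space measure \<Rightarrow> 'a \<Rightarrow> real" where
  "tukey_depth \<mu> x = (INF H\<in>{H. closed_halfspace H \<and> x \<in> H}. measure \<mu> H)"

text \<open>
  The variance of a random variable is at most \<open>c\<close>. The Bochner integral of a non-integrable
  function is 0, so a bound on the variance means something only together with integrability
  of the variable and of its square.
\<close>

definition variance_le :: "'a measure \<Rightarrow> ('a \<Rightarrow> real) \<Rightarrow> real \<Rightarrow> bool" where
  "variance_le \<mu> f c \<longleftrightarrow>
     integrable \<mu> f \<and> integrable \<mu> (\<lambda>x. (f x)\<^sup>2) \<and> prob_space.variance \<mu> f \<le> c"

text \<open>
  The function \<open>- log q\<close>, for the depth \<open>q\<close> of a measure, takes the value \<open>\<infinity>\<close> where \<open>q\<close> vanishes,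
  whereas \<open>ln 0 = 0\<close>. The variance of the extended-valued function is finite only if \<open>q\<close> is
  positive almost everywhere, and then it agrees with that of the real-valued one; so positivity
  is part of the bound.
\<close>

definition log_depth_variance_le :: "'a::euclidean_space measure \<Rightarrow> real \<Rightarrow> bool" where
  "log_depth_variance_le \<mu> c \<longleftrightarrow>
     (AE x in \<mu>. tukey_depth \<mu> x > 0) \<and> variance_le \<mu> (\<lambda>x. - ln (tukey_depth \<mu> x)) c"

end

theory Submission
  imports Defs
begin

text \<open>
  Let \<open>q\<close> be the depth. For a fixed direction, the measure of the half-space through \<open>x\<close> has a concave \<open>s\<close>-th
  power as a function of \<open>x\<close>; an infimum over directions keeps this, so \<open>q powr s\<close> is concave
  where it is positive (\<open>depth_concave\<close>). Hence
  convex combinations of superlevel sets of \<open>q powr s\<close> lie in superlevel sets, and concavity of the measure makes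
  \<open>\<mu> {x. r \<le> q x powr s}\<close> a log-concave function of \<open>r > 0\<close>. It tends to 1 as \<open>r\<close> tends to 0, because \<open>q\<close> is positive on
  the interior of the body and the boundary is a null set. So when the level \<open>r\<close> shrinks by a factor
  \<open>t = exp (- s * d)\<close>, the new tail is at least the \<open>t\<close>-th power of the old one. In terms of the distribution function \<open>F\<close>
  of \<open>Y = - ln q\<close> this reads \<open>F y powr exp (- s * d) \<le> F (y + d)\<close> (\<open>tail_shrink\<close>).

  Equality holds here for the Gumbel law \<open>F y = exp (- exp (- s * y))\<close>, the law of \<open>- ln E / s\<close> with \<open>E\<close> a standard
  exponential variable. The inequality says that the quantile function of \<open>Y\<close> has smaller increments than that of the
  Gumbel law, so \<open>Y\<close> has smaller variance (\<open>variance_le_if_cdf_spread\<close>). The variance of \<open>ln E\<close> is \<open>pi\<^sup>2 / 6\<close>, the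
  second derivative of \<open>ln_Gamma\<close> at 1 (\<open>log_exponential_second_moment\<close>).

  For the uniform measure on a convex body, \<open>s\<close>-concavity with \<open>s = 1 / n\<close> is the Brunn-Minkowski inequality. It is
  derived from the Prekopa-Leindler inequality, which passes from the line to \<open>n\<close> dimensions by integrating over one
  coordinate at a time (\<open>prekopa_leindler_PiM\<close>).
\<close>

section \<open>The logarithm of an exponential variable\<close>

abbreviation unit_uniform :: "real measure" where
  "unit_uniform \<equiv> restrict_space lborel {0<..<1}"

lemma prob_space_unit_uniform: "prob_space unit_uniform"
  by (auto simp: emeasure_restrict_space space_restrict_space intro!: prob_spaceI)

lemma distributed_neg_ln_unit_uniform:
  "distributed unit_uniform lborel (\<lambda>u. - ln u) (exponential_density 1)"
proof (rule exponential_distributedI)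
  show "(\<lambda>u::real. - ln u) \<in> borel_measurable unit_uniform"
    by (intro measurable_restrict_space1) simp
  fix a :: real assume a: "0 \<le> a"
  have "{u \<in> space unit_uniform. - ln u \<le> a} = {exp (- a) ..< 1}"
  proof (rule set_eqI)
    fix u :: real
    have "- a \<le> ln u \<longleftrightarrow> exp (- a) \<le> u" if "0 < u"
      using ln_ge_iff[OF that] .
    moreover have "0 < u" if "exp (- a) \<le> u"
      using exp_gt_zero that by (rule order_less_le_trans)
    ultimately show "u \<in> {u \<in> space unit_uniform. - ln u \<le> a} \<longleftrightarrow> u \<in> {exp (- a) ..< 1}"
      unfolding space_restrict_space minus_le_iff[of "ln u" a] by auto
  qed
  moreover have "emeasure unit_uniform {exp (- a) ..< 1} = emeasure lborel {exp (- a) ..< 1}"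
    by (subst emeasure_restrict_space) (auto dest: order_less_le_trans[OF exp_gt_zero])
  ultimately show "emeasure unit_uniform {u \<in> space unit_uniform. - ln u \<le> a} = 1 - ennreal (exp (- a * 1))"
    using a by (simp add: ennreal_minus ennreal_1[symmetric] del: ennreal_1)
qed simp

lemma nn_integral_neg_ln_powr:
  fixes h :: real
  assumes "h > -1"
  shows "(\<integral>\<^sup>+u. ennreal ((- ln u) powr h) \<partial>unit_uniform) = ennreal (Gamma (1 + h))"
proof -
  have "(\<integral>\<^sup>+u. ennreal ((- ln u) powr h) \<partial>unit_uniform)
      = (\<integral>\<^sup>+x. ennreal (exponential_density 1 x) * ennreal (x powr h) \<partial>lborel)"
    by (subst distributed_nn_integral[OF distributed_neg_ln_unit_uniform, symmetric]) auto
  also have "\<dots> = (\<integral>\<^sup>+t. ennreal (indicator {0..} t * t powr (1 + h - 1) / exp t) \<partial>lborel)"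
    by (intro nn_integral_cong)
       (auto simp: exponential_density_def erlang_density_def ennreal_mult'[symmetric] exp_minus
                   field_simps split: split_indicator)
  finally show ?thesis
    using Gamma_conv_nn_integral_real[of "1 + h"] assms by simp
qed

lemma trigamma_at_1: "Polygamma (Suc 0) (1::real) = pi\<^sup>2 / 6"
proof -
  have "(\<lambda>k. inverse ((1 + real k)\<^sup>2)) sums Polygamma (Suc 0) (1::real)"
    using Polygamma_LIMSEQ[of "1::real" 1] by (simp add: numeral_2_eq_2)
  moreover have "(\<lambda>k. inverse ((1 + real k)\<^sup>2)) sums (pi\<^sup>2 / 6)"
    using inverse_squares_sums by (simp add: field_simps)
  ultimately show ?thesis
    by (rule sums_unique2)
qed

lemma square_plus_2_le_exp:
  fixes z :: real
  shows "z\<^sup>2 + 2 \<le> exp z + exp (- z)"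
proof -
  have "(z/2)\<^sup>2 \<le> (sinh (z/2))\<^sup>2"
    using real_le_abs_sinh[of "z/2"] unfolding abs_le_square_iff[symmetric] sinh_def exp_minus
    by simp
  also have "\<dots> = (exp z + exp (- z) - 2) / 4"
  proof -
    have e: "exp z = (exp (z/2))\<^sup>2" "exp (- z) = (exp (-(z/2)))\<^sup>2"
      using exp_double[of "z/2"] exp_double[of "-(z/2)"] by simp_all
    have "exp (z/2) * exp (- (z/2)) = 1"
      by (simp flip: exp_add)
    then show ?thesis
      unfolding e sinh_def power2_eq_square by (simp add: algebra_simps)
  qed
  finally show ?thesis by (simp add: power2_eq_square)
qed

text \<open>
The function \<open>k\<close> is the logarithm of \<open>h \<mapsto> exp (\<gamma> * h) * Gamma (1 + h)\<close>, with \<open>\<gamma>\<close> the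
Euler-Mascheroni constant. The linear term makes \<open>k\<close> vanish to second order at 0, because
\<open>Digamma 1 = - \<gamma>\<close>; its second derivative there is \<open>Polygamma 1 1 = pi\<^sup>2 / 6\<close>. The limit is
then a symmetric second difference, and l'Hopital's rule turns it into the derivative of \<open>R'\<close> at 0.
\<close>

lemma Gamma_second_difference:
  defines "k \<equiv> \<lambda>h::real. ln_Gamma (1 + h) + euler_mascheroni * h"
  shows "((\<lambda>h. (exp (k h) + exp (k (- h)) - 2) / h\<^sup>2) \<longlongrightarrow> pi\<^sup>2 / 6) (at_right 0)"
proof -
  define k' :: "real \<Rightarrow> real" where "k' \<equiv> \<lambda>h. Digamma (1 + h) + euler_mascheroni"
  define R' where "R' \<equiv> \<lambda>h. exp (k h) * k' h - exp (k (- h)) * k' (- h)"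
  have k: "(k has_field_derivative k' h) (at h)" if "h > -1" for h
    using that unfolding k_def k'_def by (auto intro!: derivative_eq_intros)
  have k': "(k' has_field_derivative Polygamma 1 (1 + h)) (at h)" if "h > -1" for h
    using that unfolding k'_def by (auto intro!: derivative_eq_intros elim!: nonpos_Ints_cases)
  have km: "((\<lambda>h. k (- h)) has_field_derivative - k' (- h)) (at h)" if "h < 1" for h
    using k[of "-h"] that by (simp add: DERIV_mirror)
  have k'm: "((\<lambda>h. k' (- h)) has_field_derivative - Polygamma 1 (1 - h)) (at h)" if "h < 1" for h
    using k'[of "-h"] that by (simp add: DERIV_mirror)
  have [simp]: "k 0 = 0" "k' 0 = 0"
    by (simp_all add: k_def k'_def ln_Gamma_real_pos)
  have R: "((\<lambda>h. exp (k h) + exp (k (- h)) - 2) has_field_derivative R' h) (at h)"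
    if "\<bar>h\<bar> < 1" for h
    using that unfolding R'_def by (auto intro!: derivative_eq_intros k km)
  have R'0: "(R' has_field_derivative pi\<^sup>2 / 3) (at 0)"
    unfolding R'_def
    by (rule derivative_eq_intros k km k' k'm refl | simp add: trigamma_at_1)+
  have lim: "((\<lambda>h. R' h / (2 * h)) \<longlongrightarrow> pi\<^sup>2 / 6) (at_right 0)"
  proof -
    have "((\<lambda>h. R' h / h) \<longlongrightarrow> pi\<^sup>2 / 3) (at 0)"
      using R'0 unfolding has_field_derivative_iff by (simp add: R'_def)
    then have "((\<lambda>h. R' h / h / 2) \<longlongrightarrow> pi\<^sup>2 / 3 / 2) (at_right 0)"
      by (intro tendsto_divide[OF _ tendsto_const]) (simp_all add: filterlim_at_split)
    then show ?thesis by (simp add: mult.commute)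
  qed
  have near: "\<forall>\<^sub>F h in at_right (0::real). 0 < h \<and> h < 1"
    using eventually_at_right_less[of "0::real"] eventually_at_right_real[of 0 1] by (auto elim: eventually_mono)
  show ?thesis
  proof (rule lhopital_right_0[OF _ _ _ _ _ _ lim])
    have "isCont (\<lambda>h. exp (k h) + exp (k (- h)) - 2) 0"
      by (rule DERIV_isCont[OF R]) simp
    then show "((\<lambda>h. exp (k h) + exp (k (- h)) - 2) \<longlongrightarrow> 0) (at_right 0)"
      by (auto simp: isCont_def filterlim_at_split)
    show "((\<lambda>h::real. h\<^sup>2) \<longlongrightarrow> 0) (at_right 0)"
      by (auto intro!: tendsto_eq_intros)
    show "\<forall>\<^sub>F h in at_right 0. ((\<lambda>h. exp (k h) + exp (k (- h)) - 2) has_real_derivative R' h) (at h)"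
      using near by eventually_elim (auto intro!: R)
  qed (use near in \<open>auto elim!: eventually_mono intro!: derivative_eq_intros\<close>)
qed

text \<open>
If \<open>u\<close> is uniform on \<open>(0, 1)\<close>, then \<open>E = - ln u\<close> is a standard exponential variable and
\<open>Z = ln E + \<gamma>\<close> is a centred Gumbel variable up to sign, whose variance is \<open>pi\<^sup>2 / 6\<close>.
Differentiating the moment generating function \<open>exp (k h)\<close> of \<open>Z\<close> twice under the integral is avoided by
\<open>(h * Z)\<^sup>2 + 2 \<le> exp (h * Z) + exp (- h * Z)\<close>: integrating, dividing by \<open>h\<^sup>2\<close>
and letting \<open>h\<close> tend to 0 bounds the second moment by the second difference computed above.
\<close>

lemma log_exponential_second_moment:
  "(\<integral>\<^sup>+u. ennreal ((ln (- ln u) + euler_mascheroni)\<^sup>2) \<partial>unit_uniform) \<le> ennreal (pi\<^sup>2 / 6)"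
    (is "?N \<le> _")
proof -
  define k where "k \<equiv> \<lambda>h::real. ln_Gamma (1 + h) + euler_mascheroni * h"
  have [measurable]: "(\<lambda>u. - ln u) \<in> borel_measurable unit_uniform"
    by (intro measurable_restrict_space1) simp
  have space_1: "emeasure unit_uniform {0<..<1} = 1"
    by (simp add: emeasure_restrict_space)
  have mgf: "(\<integral>\<^sup>+u. ennreal (exp (h * (ln (- ln u) + euler_mascheroni))) \<partial>unit_uniform)
      = ennreal (exp (k h))" if h: "h > -1" for h
  proof -
    have "(\<integral>\<^sup>+u. ennreal (exp (h * (ln (- ln u) + euler_mascheroni))) \<partial>unit_uniform)
        = (\<integral>\<^sup>+u. ennreal (exp (h * euler_mascheroni)) * ennreal ((- ln u) powr h) \<partial>unit_uniform)"
      by (intro nn_integral_cong)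
         (auto simp: space_restrict_space ennreal_mult'[symmetric] powr_def exp_add algebra_simps)
    also have "\<dots> = ennreal (exp (h * euler_mascheroni)) * ennreal (Gamma (1 + h))"
      using h by (simp add: nn_integral_cmult nn_integral_neg_ln_powr)
    also have "\<dots> = ennreal (exp (k h))"
      using h by (simp add: ennreal_mult'[symmetric] k_def exp_add Gamma_real_pos_exp mult.commute)
    finally show ?thesis .
  qed
  have bound: "?N \<le> ennreal ((exp (k h) + exp (k (- h)) - 2) / h\<^sup>2)" if h: "0 < h" "h < 1" for h
  proof -
    have "ennreal (h\<^sup>2) * ?N + 2
        = (\<integral>\<^sup>+u. ennreal ((h * (ln (- ln u) + euler_mascheroni))\<^sup>2 + 2) \<partial>unit_uniform)"
      by (simp add: nn_integral_add nn_integral_cmult power_mult_distrib ennreal_mult' space_1)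
    also have "\<dots> \<le> (\<integral>\<^sup>+u. ennreal (exp (h * (ln (- ln u) + euler_mascheroni)))
                        + ennreal (exp ((- h) * (ln (- ln u) + euler_mascheroni))) \<partial>unit_uniform)"
      using square_plus_2_le_exp
      by (intro nn_integral_mono) (auto simp: ennreal_plus[symmetric] simp del: ennreal_plus)
    also have "\<dots> = ennreal (exp (k h)) + ennreal (exp (k (- h)))"
      using h by (subst nn_integral_add) (auto simp only: mgf, auto)
    finally have *: "ennreal (h\<^sup>2) * ?N + 2 \<le> ennreal (exp (k h) + exp (k (- h)))"
      by simp
    then have fin: "?N < \<infinity>"
      using h by (cases ?N) (auto simp: ennreal_mult_top top_unique)
    then obtain r where r: "?N = ennreal r" "r \<ge> 0"
      by (cases ?N) auto
    have "ennreal (h\<^sup>2 * r + 2) \<le> ennreal (exp (k h) + exp (k (- h)))"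
      using * r h by (simp add: ennreal_mult')
    then have "h\<^sup>2 * r + 2 \<le> exp (k h) + exp (k (- h))"
      by (subst (asm) ennreal_le_iff) (auto intro: add_nonneg_nonneg)
    then show ?thesis
      using h r by (auto simp: field_simps intro!: ennreal_leI)
  qed
  have near: "\<forall>\<^sub>F h in at_right (0::real). 0 < h \<and> h < 1"
    using eventually_at_right_less[of "0::real"] eventually_at_right_real[of 0 1] by (auto elim: eventually_mono)
  show ?thesis
  proof (rule tendsto_lowerbound)
    show "((\<lambda>h. ennreal ((exp (k h) + exp (k (- h)) - 2) / h\<^sup>2)) \<longlongrightarrow> ennreal (pi\<^sup>2 / 6)) (at_right 0)"
      unfolding k_def by (intro tendsto_ennrealI Gamma_second_difference)
    show "\<forall>\<^sub>F h in at_right 0. ?N \<le> ennreal ((exp (k h) + exp (k (- h)) - 2) / h\<^sup>2)"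
      using near by eventually_elim (rule bound, auto)
  qed simp
qed

section \<open>Comparison of quantile functions\<close>

text \<open>
The hypothesis compares the distribution function \<open>F\<close> of \<open>Y\<close> with the Gumbel distribution
\<open>G y = exp (- exp (- s * y))\<close>, for which \<open>G y powr exp (- s * d) = G (y + d)\<close> holds with equality.
It says that the quantile function \<open>I\<close> of \<open>Y\<close> grows more slowly than the quantile function
\<open>J u = - ln (- ln u) / s\<close> of \<open>G\<close>: \<open>I v - I u \<le> J v - J u\<close> whenever \<open>u < v\<close>. Under the
uniform law on \<open>(0, 1)\<close> the function \<open>I\<close> has the law of \<open>Y\<close>, so a bound on the variance of \<open>Y\<close> follows
by comparing the squared distances of \<open>I\<close> and \<open>J\<close> from their values at one common point \<open>u\<^sub>0\<close>.
\<close>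

lemma variance_le_if_cdf_spread:
  fixes Y :: "'a \<Rightarrow> real"
  assumes M: "prob_space M" and Y[measurable]: "Y \<in> borel_measurable M" and s: "0 < s"
    and spread: "\<And>y d. 0 < d \<Longrightarrow> 0 < measure M {x\<in>space M. Y x \<le> y} \<Longrightarrow>
      measure M {x\<in>space M. Y x \<le> y} powr exp (- s * d) \<le> measure M {x\<in>space M. Y x \<le> y + d}"
  shows "integrable M Y \<and> integrable M (\<lambda>x. (Y x)\<^sup>2) \<and>
    prob_space.variance M Y \<le> pi\<^sup>2 / (6 * s\<^sup>2)"
proof -
  interpret M: prob_space M by (rule M)
  interpret D: cdf_distribution "distr M borel Y"
    unfolding cdf_distribution_def by (rule M.real_distribution_distr) simp
  define J :: "real \<Rightarrow> real" where "J u = - ln (- ln u) / s" for u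
  \<comment> \<open>the point where \<open>J\<close> takes its mean value \<open>\<gamma> / s\<close>; the choice makes the bound for \<open>J\<close> sharp\<close>
  define u\<^sub>0 :: real where "u\<^sub>0 = exp (- exp (- euler_mascheroni))"
  have u0: "0 < u\<^sub>0" "u\<^sub>0 < 1" by (auto simp: u\<^sub>0_def)
  have J0: "J u - J u\<^sub>0 = - (ln (- ln u) + euler_mascheroni) / s" for u
    using s by (simp add: J_def u\<^sub>0_def field_simps)
  have J0sq: "(J u - J u\<^sub>0)\<^sup>2 = (ln (- ln u) + euler_mascheroni)\<^sup>2 / s\<^sup>2" for u
    unfolding J0 power_divide power2_minus ..
  have C: "D.C y = measure M {x\<in>space M. Y x \<le> y}" for y
    unfolding cdf_def by (subst measure_distr) (auto intro!: arg_cong2[where f = measure])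
  have [measurable]: "D.I \<in> borel_measurable unit_uniform"
    using D.measurable_CI
    by (subst measurable_cong_sets[OF sets_restrict_space_cong[OF sets_lborel] refl])
  have gap: "D.I u \<le> D.I v \<and> D.I v - D.I u \<le> J v - J u" if uv: "0 < u" "u < v" "v < 1" for u v
  proof
    show "D.I u \<le> D.I v"
      using D.mono_I uv by (auto simp: mono_on_def)
    have ln: "ln u < ln v" "ln v < 0" using uv by auto
    define d where "d = J v - J u"
    have "exp (- s * d) = exp (ln (- ln v) - ln (- ln u))"
      using s by (simp add: d_def J_def field_simps)
    also have "\<dots> = ln v / ln u"
      using ln by (simp add: exp_diff)
    finally have e: "exp (- s * d) = ln v / ln u" .
    have d: "d > 0"
      using ln s by (simp add: d_def J_def divide_strict_right_mono)
    have u: "u \<le> D.C (D.I u)"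
      using D.pseudoinverse[of u "D.I u"] uv by simp
    \<comment> \<open>the displacement \<open>d\<close> is chosen so that raising \<open>u\<close> to the power \<open>exp (- s * d)\<close> gives \<open>v\<close>\<close>
    have "v = u powr (ln v / ln u)"
      using uv ln by (simp add: powr_def)
    also have "\<dots> \<le> D.C (D.I u) powr exp (- s * d)"
      unfolding e using u uv ln by (intro powr_mono2) (auto simp: divide_nonpos_nonpos)
    also have "\<dots> \<le> D.C (D.I u + d)"
      using spread[OF d, of "D.I u"] u uv by (simp add: C)
    finally have "D.I v \<le> D.I u + d"
      using D.pseudoinverse[of v "D.I u + d"] uv by simp
    then show "D.I v - D.I u \<le> J v - J u" by (simp add: d_def)
  qed
  define c where "c = D.I u\<^sub>0"
  have dom: "(D.I u - c)\<^sup>2 \<le> (J u - J u\<^sub>0)\<^sup>2" if "u \<in> {0<..<1}" for u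
    using gap[of u u\<^sub>0] gap[of u\<^sub>0 u] that u0
    by (cases u u\<^sub>0 rule: linorder_cases) (auto simp: c_def simp flip: abs_le_square_iff)
  have "(\<integral>\<^sup>+x. ennreal ((Y x - c)\<^sup>2) \<partial>M) = (\<integral>\<^sup>+y. ennreal ((y - c)\<^sup>2) \<partial>distr M borel Y)"
    by (simp add: nn_integral_distr)
  also have "\<dots> = (\<integral>\<^sup>+u. ennreal ((D.I u - c)\<^sup>2) \<partial>unit_uniform)"
    by (subst D.distr_I_eq_M[symmetric], subst nn_integral_distr) auto
  also have "\<dots> \<le> (\<integral>\<^sup>+u. ennreal (1 / s\<^sup>2) * ennreal ((ln (- ln u) + euler_mascheroni)\<^sup>2) \<partial>unit_uniform)"
  proof (rule nn_integral_mono)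
    fix u assume "u \<in> space unit_uniform"
    then have "(D.I u - c)\<^sup>2 \<le> (1 / s\<^sup>2) * (ln (- ln u) + euler_mascheroni)\<^sup>2"
      using dom[of u] unfolding J0sq by (simp add: space_restrict_space)
    then show "ennreal ((D.I u - c)\<^sup>2) \<le> ennreal (1 / s\<^sup>2) * ennreal ((ln (- ln u) + euler_mascheroni)\<^sup>2)"
      by (simp add: ennreal_mult'[symmetric])
  qed
  also have "\<dots> = ennreal (1 / s\<^sup>2) * (\<integral>\<^sup>+u. ennreal ((ln (- ln u) + euler_mascheroni)\<^sup>2) \<partial>unit_uniform)"
    by (rule nn_integral_cmult) (intro measurable_restrict_space1, measurable)
  also have "\<dots> \<le> ennreal (1 / s\<^sup>2) * ennreal (pi\<^sup>2 / 6)"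
    by (intro mult_left_mono log_exponential_second_moment) simp
  also have "\<dots> = ennreal (pi\<^sup>2 / (6 * s\<^sup>2))"
    by (simp add: ennreal_mult'[symmetric] field_simps)
  finally have sq: "(\<integral>\<^sup>+x. ennreal ((Y x - c)\<^sup>2) \<partial>M) \<le> ennreal (pi\<^sup>2 / (6 * s\<^sup>2))" .
  have int2c: "integrable M (\<lambda>x. (Y x - c)\<^sup>2)"
    using sq by (intro integrableI_nonneg) (auto intro: order_le_less_trans)
  then have int1c: "integrable M (\<lambda>x. Y x - c)"
    by (rule M.square_integrable_imp_integrable[rotated]) measurable
  then have int: "integrable M Y"
    using Bochner_Integration.integrable_add[OF int1c, of "\<lambda>_. c"] by simp
  have "integrable M (\<lambda>x. (Y x - c)\<^sup>2 + 2 * c * Y x - c\<^sup>2)"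
    using int2c int by auto
  then have int2: "integrable M (\<lambda>x. (Y x)\<^sup>2)"
    by (simp add: power2_diff algebra_simps)
  \<comment> \<open>the mean minimises the quadratic deviation\<close>
  have "M.variance Y \<le> M.expectation (\<lambda>x. (Y x - c)\<^sup>2)"
  proof -
    have "M.expectation (\<lambda>x. (Y x - c)\<^sup>2) = M.expectation (\<lambda>x. (Y x)\<^sup>2) - 2 * c * M.expectation Y + c\<^sup>2"
      using int int2 by (simp add: power2_diff M.prob_space algebra_simps)
    also have "\<dots> = M.variance Y + (M.expectation Y - c)\<^sup>2"
      using M.variance_eq[OF int int2] by (simp add: power2_diff)
    finally show ?thesis by simp
  qed
  also have "\<dots> \<le> pi\<^sup>2 / (6 * s\<^sup>2)"
    using sq by (subst integral_eq_nn_integral) (auto intro!: enn2real_leI)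
  finally show ?thesis using int int2 by blast
qed

section \<open>The depth of an s-concave measure on a convex body\<close>

locale s_concave_on_body =
  fixes s :: real and \<mu> :: "'a::euclidean_space measure" and K :: "'a set"
  assumes s_pos: "0 < s" and s_concave: "s_concave s \<mu>"
    and body: "convex_body K" and support: "measure_support \<mu> = K"
begin

lemma borel_prob: "borel_prob \<mu>"
  using s_concave by (simp add: s_concave_def)

sublocale prob_space \<mu>
  using borel_prob by (simp add: borel_prob_def)

lemma sets_eq[measurable_cong, simp]: "sets \<mu> = sets borel"
  using borel_prob by (simp add: borel_prob_def)

lemma space_eq[simp]: "space \<mu> = UNIV"
  using sets_eq_imp_space_eq[OF sets_eq] by simp

lemma compact_K: "compact K" and convex_K: "convex K" and interior_K: "interior K \<noteq> {}"
  using body by (auto simp: convex_body_def)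

lemma K_borel[measurable]: "K \<in> sets borel"
  by (rule borel_compact[OF compact_K])

lemma powr_s_inverse: "0 \<le> x \<Longrightarrow> (x powr s) powr (1 / s) = x"
  using s_pos by (simp add: powr_powr)

text \<open>
Enlarging the Minkowski combination to any Borel superset \<open>C\<close> is how concavity is used for half-spaces and
for superlevel sets of the depth, which only contain the combinations of smaller sets of the same kind.
\<close>

lemma measure_concave:
  assumes "compact A" "compact B" "0 < measure \<mu> A" "0 < measure \<mu> B" "0 \<le> t" "t \<le> 1"
    and C: "C \<in> sets borel"
    and sub: "\<And>a b. a \<in> A \<Longrightarrow> b \<in> B \<Longrightarrow> (1 - t) *\<^sub>R a + t *\<^sub>R b \<in> C"
  shows "(1 - t) * measure \<mu> A powr s + t * measure \<mu> B powr s \<le> measure \<mu> C powr s"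
proof -
  have "(1 - t) * measure \<mu> A powr s + t * measure \<mu> B powr s
      \<le> measure \<mu> {(1 - t) *\<^sub>R a + t *\<^sub>R b | a b. a \<in> A \<and> b \<in> B} powr s"
    using s_concave assms(1-6) unfolding s_concave_def by auto
  also have "\<dots> \<le> measure \<mu> C powr s"
    using sub C s_pos by (intro powr_mono2 finite_measure_mono) auto
  finally show ?thesis .
qed

lemma measure_ball_pos: "x \<in> K \<Longrightarrow> 0 < r \<Longrightarrow> 0 < measure \<mu> (ball x r)"
  unfolding support[symmetric] measure_support_def by auto

lemma measure_K: "measure \<mu> K = 1"
proof -
  let ?F = "{U :: 'a set. open U \<and> measure \<mu> U = 0}"
  have "\<Union>?F = - K"
    unfolding support[symmetric] measure_support_def
    by (auto simp: less_le)
  moreover obtain F where F: "F \<subseteq> ?F" "countable F" "\<Union>F = \<Union>?F"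
    by (rule Lindelof[of ?F]) auto
  moreover have "\<Union>F \<in> null_sets \<mu>"
    using F(1) by (intro null_sets_UN'[OF F(2), of id, simplified]) (auto simp: emeasure_eq_measure null_sets_def)
  ultimately have "measure \<mu> (- K) = 0"
    by (metis measure_eq_0_null_sets)
  then show ?thesis
    using prob_compl[of K] by (simp add: Compl_eq_Diff_UNIV)
qed

lemma measure_K_Int: "A \<in> sets borel \<Longrightarrow> measure \<mu> (K \<inter> A) = measure \<mu> A"
  using measure_K by (intro finite_measure_eq_AE) (auto simp: prob_eq_1 elim!: eventually_mono)

text \<open>
The boundary carries no mass: for a ball \<open>B\<close> in the interior, the set \<open>(1 - t) B + t K\<close> lies in
the interior of \<open>K\<close> for all \<open>t < 1\<close>, and by concavity the \<open>s\<close>-th power of its measure is at least \<open>t\<close>.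
\<close>

lemma measure_interior_K: "measure \<mu> (interior K) = 1"
proof -
  obtain c where c: "c \<in> interior K" using interior_K by auto
  then obtain r where r: "0 < r" "cball c r \<subseteq> interior K"
    using open_contains_cball[of "interior K"] by auto
  have "0 < measure \<mu> (ball c r)"
    using c r interior_subset by (intro measure_ball_pos) auto
  also have "\<dots> \<le> measure \<mu> (cball c r)"
    by (intro finite_measure_mono) auto
  finally have pos: "0 < measure \<mu> (cball c r)" .
  have "1 \<le> measure \<mu> (interior K) powr s"
  proof (rule field_le_mult_one_interval)
    fix t :: real assume t: "0 < t" "t < 1"
    have "(1 - t) * measure \<mu> (cball c r) powr s + t * measure \<mu> K powr s \<le> measure \<mu> (interior K) powr s"
    proof (rule measure_concave)
      fix a b assume a: "a \<in> cball c r" and b: "b \<in> K"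
      have "b - (1 - t) *\<^sub>R (b - a) \<in> interior K"
        using a b r t by (intro mem_interior_convex_shrink convex_K) auto
      then show "(1 - t) *\<^sub>R a + t *\<^sub>R b \<in> interior K"
        by (simp add: algebra_simps)
    qed (use t pos compact_K measure_K in auto)
    moreover have "0 \<le> (1 - t) * measure \<mu> (cball c r) powr s"
      using t by simp
    ultimately show "t * 1 \<le> measure \<mu> (interior K) powr s"
      by (simp add: measure_K)
  qed
  moreover have "measure \<mu> (interior K) powr s < 1" if "measure \<mu> (interior K) < 1"
    using that s_pos powr_less_mono2[of s "measure \<mu> (interior K)" 1] by simp
  ultimately show ?thesis
    using prob_le_1[of "interior K"] by (meson antisym not_le)
qed

lemma depth_ge_iff:
  "c \<le> tukey_depth \<mu> x \<longleftrightarrow> (\<forall>a b. a \<noteq> 0 \<longrightarrow> a \<bullet> x \<le> b \<longrightarrow> c \<le> measure \<mu> {y. a \<bullet> y \<le> b})"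
proof -
  let ?H = "{H. closed_halfspace H \<and> x \<in> H}"
  obtain e :: 'a where "e \<in> Basis" using nonempty_Basis by blast
  then have "{y. e \<bullet> y \<le> e \<bullet> x} \<in> ?H"
    by (auto simp: closed_halfspace_def intro!: exI[of _ e] exI[of _ "e \<bullet> x"])
  then have ne: "?H \<noteq> {}" by blast
  have bdd: "bdd_below (measure \<mu> ` ?H)"
    by (rule bdd_belowI[of _ 0]) auto
  have "c \<le> tukey_depth \<mu> x \<longleftrightarrow> (\<forall>H\<in>?H. c \<le> measure \<mu> H)"
    unfolding tukey_depth_def using ne bdd by (rule le_cINF_iff)
  also have "\<dots> \<longleftrightarrow> (\<forall>a b. a \<noteq> 0 \<longrightarrow> a \<bullet> x \<le> b \<longrightarrow> c \<le> measure \<mu> {y. a \<bullet> y \<le> b})"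
    by (auto simp: closed_halfspace_def)
  finally show ?thesis .
qed

text \<open>
The depth is upper semicontinuous: a closed half-space through \<open>x\<close> of measure below \<open>c\<close> can be moved
outwards a little without its measure reaching \<open>c\<close>, and then it contains a neighbourhood of \<open>x\<close>.
\<close>

lemma closed_depth_superlevel: "closed {x. c \<le> tukey_depth \<mu> x}"
proof -
  have "\<exists>U. open U \<and> x \<in> U \<and> U \<subseteq> - {x. c \<le> tukey_depth \<mu> x}" if x: "x \<in> - {x. c \<le> tukey_depth \<mu> x}" for x
  proof -
    obtain a b where ab: "a \<noteq> 0" "a \<bullet> x \<le> b" "measure \<mu> {y. a \<bullet> y \<le> b} < c"
      using x by (auto simp: depth_ge_iff not_le)
    define H where "H n = {y. a \<bullet> y \<le> b + 1 / real (Suc n)}" for n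
    have H: "closed (H n)" for n
      unfolding H_def by (rule closed_halfspace_le)
    have "decseq H"
      unfolding decseq_def H_def by (auto intro: order_trans simp: frac_le)
    moreover have "(\<Inter>n. H n) = {y. a \<bullet> y \<le> b}"
    proof (intro set_eqI iffI)
      fix y assume y: "y \<in> (\<Inter>n. H n)"
      have "(\<lambda>n. b + 1 / real (Suc n)) \<longlonglongrightarrow> b + 0"
        by (intro tendsto_add tendsto_const LIMSEQ_Suc[OF lim_1_over_n])
      then show "y \<in> {y. a \<bullet> y \<le> b}"
        using y by (auto simp: H_def intro: LIMSEQ_le_const)
    qed (auto simp: H_def intro: add_increasing2)
    ultimately have "(\<lambda>n. measure \<mu> (H n)) \<longlonglongrightarrow> measure \<mu> {y. a \<bullet> y \<le> b}"
      using finite_Lim_measure_decseq[of H] H by (simp add: image_subset_iff borel_closed)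
    then have "\<forall>\<^sub>F n in sequentially. measure \<mu> (H n) < c"
      using ab(3) by (rule order_tendstoD)
    then obtain n where n: "measure \<mu> (H n) < c"
      by (auto simp: eventually_sequentially)
    let ?U = "{y. a \<bullet> y < b + 1 / real (Suc n)}"
    have "\<not> c \<le> tukey_depth \<mu> y" if "y \<in> ?U" for y
      using that n ab(1) unfolding depth_ge_iff H_def by (auto simp: not_le intro!: exI[of _ a] exI[of _ "b + 1 / real (Suc n)"])
    moreover have "x \<in> ?U"
      using ab(2) by (auto intro: order_le_less_trans)
    moreover have "open ?U" by (rule open_halfspace_lt)
    ultimately show ?thesis by blast
  qed
  then show ?thesis
    unfolding closed_def by (subst open_subopen) blast
qed

lemma depth_measurable[measurable]: "tukey_depth \<mu> \<in> borel_measurable \<mu>"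
  by (rule borel_measurable_iff_ge[THEN iffD2]) (simp add: borel_closed closed_depth_superlevel)

text \<open>
Every closed half-space containing \<open>x\<close> contains a ball of radius \<open>r / 2\<close> whose centre \<open>p\<close> is at distance
\<open>r / 2\<close> from \<open>x\<close>, hence one of finitely many balls of radius \<open>r / 4\<close> that cover \<open>cball x (r / 2)\<close>. Their measures
have a positive minimum, which bounds the depth of \<open>x\<close> from below.
\<close>

lemma depth_pos_interior:
  assumes x: "x \<in> interior K"
  shows "0 < tukey_depth \<mu> x"
proof -
  obtain r where r: "0 < r" "cball x r \<subseteq> K"
    using x by (auto simp: mem_interior_cball)
  obtain Z where Z: "finite Z" "Z \<subseteq> cball x (r/2)" "cball x (r/2) \<subseteq> (\<Union>z\<in>Z. ball z (r/4))"
    using compactE_image[OF compact_cball[of x "r/2"], of "cball x (r/2)" "\<lambda>z. ball z (r/4)"] r by force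
  define m where "m = Min ((\<lambda>z. measure \<mu> (ball z (r/4))) ` Z)"
  have "Z \<noteq> {}" using Z(3) r by (auto dest: subsetD[of _ _ x])
  then have "m \<in> (\<lambda>z. measure \<mu> (ball z (r/4))) ` Z"
    unfolding m_def using Z(1) by (intro Min_in) auto
  moreover have "cball x (r/2) \<subseteq> K"
    using r by (auto intro: subsetD[OF r(2)])
  ultimately have "0 < m"
    using Z(2) r(1) by (auto intro!: measure_ball_pos)
  also have "m \<le> tukey_depth \<mu> x"
    unfolding depth_ge_iff
  proof (intro allI impI)
    fix a b assume a: "a \<noteq> 0" and b: "a \<bullet> x \<le> b"
    \<comment> \<open>the inner normal of the half-space leads from \<open>x\<close> to the centre \<open>p\<close> of the inscribed ball\<close>
    define p where "p = x - (r / (2 * norm a)) *\<^sub>R a"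
    have "dist x p = r / 2"
      using a r by (simp add: p_def dist_norm)
    then have "p \<in> cball x (r/2)" by simp
    then obtain z where z: "z \<in> Z" "dist z p < r/4"
      using Z(3) by force
    have "ball z (r/4) \<subseteq> {y. a \<bullet> y \<le> b}"
    proof
      fix y assume y: "y \<in> ball z (r/4)"
      have "norm (y - p) \<le> r / 2"
        using y z dist_triangle[of y p z] by (simp add: dist_norm[symmetric] dist_commute)
      then have "a \<bullet> (y - p) \<le> norm a * (r / 2)"
        using norm_cauchy_schwarz[of a "y - p"] mult_left_mono[of "norm (y - p)" "r/2" "norm a"] by simp
      moreover have "a \<bullet> p = a \<bullet> x - norm a * (r / 2)"
        using a by (simp add: p_def inner_diff_right dot_square_norm power2_eq_square)
      ultimately show "y \<in> {y. a \<bullet> y \<le> b}"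
        using b by (simp add: inner_diff_right)
    qed
    then have "measure \<mu> (ball z (r/4)) \<le> measure \<mu> {y. a \<bullet> y \<le> b}"
      by (intro finite_measure_mono) (auto intro: borel_closed closed_halfspace_le)
    moreover have "m \<le> measure \<mu> (ball z (r/4))"
      unfolding m_def using Z(1) z(1) by (intro Min_le) auto
    ultimately show "m \<le> measure \<mu> {y. a \<bullet> y \<le> b}" by simp
  qed
  finally show ?thesis .
qed

lemma AE_depth_pos: "AE x in \<mu>. 0 < tukey_depth \<mu> x"
proof -
  have "AE x in \<mu>. x \<in> interior K"
    using measure_interior_K by (subst (asm) prob_eq_1) auto
  then show ?thesis
    by eventually_elim (rule depth_pos_interior)
qed

text \<open>
The \<open>s\<close>-th power of the depth is concave where the depth is positive, as an infimum of concave functions: for a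
fixed normal \<open>a\<close>, \<open>s\<close>-concavity of \<open>\<mu>\<close> says that \<open>c \<mapsto> \<mu> {z. a \<bullet> z \<le> c} powr s\<close> is concave.
\<close>

lemma depth_concave:
  assumes x: "\<alpha> \<le> tukey_depth \<mu> x" and y: "\<beta> \<le> tukey_depth \<mu> y" and pos: "0 < \<alpha>" "0 < \<beta>"
    and t: "0 \<le> t" "t \<le> 1"
  shows "((1 - t) * \<alpha> powr s + t * \<beta> powr s) powr (1 / s) \<le> tukey_depth \<mu> ((1 - t) *\<^sub>R x + t *\<^sub>R y)"
  unfolding depth_ge_iff
proof (intro allI impI)
  fix a b assume a: "a \<noteq> 0" and b: "a \<bullet> ((1 - t) *\<^sub>R x + t *\<^sub>R y) \<le> b"
  let ?H = "\<lambda>c. {z. a \<bullet> z \<le> c}"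
  have H[measurable]: "?H c \<in> sets borel" for c
    by (intro borel_closed closed_halfspace_le)
  have Hx: "\<alpha> \<le> measure \<mu> (?H (a \<bullet> x))" and Hy: "\<beta> \<le> measure \<mu> (?H (a \<bullet> y))"
    using x y a unfolding depth_ge_iff by auto
  have "(1 - t) * \<alpha> powr s + t * \<beta> powr s
      \<le> (1 - t) * measure \<mu> (?H (a \<bullet> x)) powr s + t * measure \<mu> (?H (a \<bullet> y)) powr s"
    using Hx Hy pos t s_pos by (intro add_mono mult_left_mono powr_mono2) auto
  also have "\<dots> = (1 - t) * measure \<mu> (K \<inter> ?H (a \<bullet> x)) powr s + t * measure \<mu> (K \<inter> ?H (a \<bullet> y)) powr s"
    by (simp add: measure_K_Int)
  also have "\<dots> \<le> measure \<mu> (?H b) powr s"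
  proof (rule measure_concave)
    show "compact (K \<inter> ?H (a \<bullet> x))" "compact (K \<inter> ?H (a \<bullet> y))"
      by (intro compact_Int_closed compact_K closed_halfspace_le)+
    show "0 < measure \<mu> (K \<inter> ?H (a \<bullet> x))" "0 < measure \<mu> (K \<inter> ?H (a \<bullet> y))"
      using Hx Hy pos by (simp_all add: measure_K_Int)
    show "(1 - t) *\<^sub>R u + t *\<^sub>R v \<in> ?H b" if "u \<in> K \<inter> ?H (a \<bullet> x)" "v \<in> K \<inter> ?H (a \<bullet> y)" for u v
    proof -
      have "a \<bullet> ((1 - t) *\<^sub>R u + t *\<^sub>R v) \<le> a \<bullet> ((1 - t) *\<^sub>R x + t *\<^sub>R y)"
        using that t by (auto simp: inner_add_right intro!: add_mono mult_left_mono)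
      then show ?thesis using b by simp
    qed
  qed (use t in auto)
  finally have "((1 - t) * \<alpha> powr s + t * \<beta> powr s) powr (1 / s) \<le> (measure \<mu> (?H b) powr s) powr (1 / s)"
    using t s_pos by (intro powr_mono2) auto
  then show "((1 - t) * \<alpha> powr s + t * \<beta> powr s) powr (1 / s) \<le> measure \<mu> (?H b)"
    by (simp only: powr_s_inverse[OF measure_nonneg])
qed

abbreviation tail :: "real \<Rightarrow> real" where
  "tail \<alpha> \<equiv> measure \<mu> {x. \<alpha> \<le> tukey_depth \<mu> x}"

lemma superlevel_borel[measurable]: "{x. \<alpha> \<le> tukey_depth \<mu> x} \<in> sets borel"
  by (intro borel_closed closed_depth_superlevel)

text \<open>
By concavity of \<open>tukey_depth \<mu> x powr s\<close> in \<open>x\<close>, a convex combination of points of two superlevel sets lies in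
the superlevel set of level \<open>\<gamma>\<close>. The \<open>s\<close>-concavity of \<open>\<mu>\<close>, weakened to log-concavity by the weighted
inequality of arithmetic and geometric means, does the rest.
\<close>

lemma tail_log_concave:
  assumes pos: "0 < \<alpha>" "0 < \<beta>" and tail: "0 < tail \<alpha>" "0 < tail \<beta>" and t: "0 \<le> t" "t \<le> 1"
  shows "tail \<alpha> powr (1 - t) * tail \<beta> powr t \<le> tail (((1 - t) * \<alpha> powr s + t * \<beta> powr s) powr (1 / s))"
    (is "_ \<le> tail ?\<gamma>")
proof -
  let ?D = "\<lambda>\<alpha>. K \<inter> {x. \<alpha> \<le> tukey_depth \<mu> x}"
  have "(tail \<alpha> powr (1 - t) * tail \<beta> powr t) powr s
      = (tail \<alpha> powr s) powr (1 - t) * (tail \<beta> powr s) powr t"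
    by (simp add: powr_mult powr_powr mult.commute)
  also have "\<dots> \<le> (1 - t) * tail \<alpha> powr s + t * tail \<beta> powr s"
    using t tail by (intro Youngs_inequality_0) auto
  also have "\<dots> = (1 - t) * measure \<mu> (?D \<alpha>) powr s + t * measure \<mu> (?D \<beta>) powr s"
    by (simp add: measure_K_Int)
  also have "\<dots> \<le> tail ?\<gamma> powr s"
  proof (rule measure_concave)
    show "compact (?D \<alpha>)" "compact (?D \<beta>)"
      by (intro compact_Int_closed compact_K closed_depth_superlevel)+
    show "0 < measure \<mu> (?D \<alpha>)" "0 < measure \<mu> (?D \<beta>)"
      using tail by (simp_all add: measure_K_Int)
    show "(1 - t) *\<^sub>R x + t *\<^sub>R y \<in> {x. ?\<gamma> \<le> tukey_depth \<mu> x}" if "x \<in> ?D \<alpha>" "y \<in> ?D \<beta>" for x y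
      using that depth_concave[of \<alpha> x \<beta> y t] pos t by auto
  qed (use t in auto)
  finally have "(tail \<alpha> powr (1 - t) * tail \<beta> powr t) powr s \<le> tail ?\<gamma> powr s" .
  from powr_mono2[OF _ _ this, of "1 / s"]
  have "((tail \<alpha> powr (1 - t) * tail \<beta> powr t) powr s) powr (1 / s) \<le> (tail ?\<gamma> powr s) powr (1 / s)"
    using s_pos by (simp only: powr_ge_zero divide_nonneg_pos zero_le_one)
  moreover have "0 \<le> tail \<alpha> powr (1 - t) * tail \<beta> powr t"
    by simp
  ultimately show ?thesis
    by (simp only: powr_s_inverse measure_nonneg)
qed

text \<open>
The case \<open>\<alpha> \<rightarrow> 0\<close> of log-concavity, with \<open>t = exp (- s * d)\<close>: the level \<open>\<gamma>\<close> tends to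
\<open>(t * \<beta> powr s) powr (1 / s) = \<beta> * exp (- d)\<close>, and \<open>tail \<alpha>\<close> tends to 1 since the depth is positive
almost everywhere. This is the growth condition on the distribution function of \<open>- ln (tukey_depth \<mu> x)\<close>.
\<close>

lemma tail_shrink:
  assumes \<beta>: "0 < \<beta>" and tail: "0 < tail \<beta>" and d: "0 < d"
  shows "tail \<beta> powr exp (- s * d) \<le> tail (\<beta> * exp (- d))"
proof -
  define t where "t = exp (- s * d)"
  have t: "0 < t" "t < 1" using s_pos d by (auto simp: t_def)
  define \<alpha> where "\<alpha> n = 1 / real (Suc n)" for n
  have \<alpha>: "0 < \<alpha> n" for n by (simp add: \<alpha>_def)
  have lim: "(\<lambda>n. tail (\<alpha> n)) \<longlonglongrightarrow> 1"
  proof -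
    let ?A = "\<lambda>n. {x. \<alpha> n \<le> tukey_depth \<mu> x}"
    have "incseq ?A"
      unfolding incseq_def \<alpha>_def by (auto intro: order_trans[rotated] simp: frac_le)
    then have "(\<lambda>n. tail (\<alpha> n)) \<longlonglongrightarrow> measure \<mu> (\<Union>n. ?A n)"
      by (intro finite_Lim_measure_incseq) auto
    also have "(\<Union>n. ?A n) = {x. 0 < tukey_depth \<mu> x}"
    proof (intro set_eqI iffI)
      fix x assume "x \<in> {x. 0 < tukey_depth \<mu> x}"
      then obtain n where "1 / real (Suc n) < tukey_depth \<mu> x"
        using nat_approx_posE by blast
      then show "x \<in> (\<Union>n. ?A n)" unfolding \<alpha>_def by (auto intro!: exI[of _ n])
    next
      fix x assume "x \<in> (\<Union>n. ?A n)"
      then show "x \<in> {x. 0 < tukey_depth \<mu> x}"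
        using \<alpha> by (auto intro: order_less_le_trans)
    qed
    also have "measure \<mu> {x. 0 < tukey_depth \<mu> x} = 1"
    proof -
      have "{x \<in> space \<mu>. 0 < tukey_depth \<mu> x} \<in> events" by measurable
      then show ?thesis
        using AE_depth_pos prob_Collect_eq_1[of "\<lambda>x. 0 < tukey_depth \<mu> x"] by simp
    qed
    finally show ?thesis .
  qed
  have "\<forall>\<^sub>F n in sequentially. 0 < tail (\<alpha> n)"
    using lim by (rule order_tendstoD) simp
  then have "\<forall>\<^sub>F n in sequentially. tail (\<alpha> n) powr (1 - t) * tail \<beta> powr t \<le> tail (\<beta> * exp (- d))"
  proof eventually_elim
    case (elim n)
    have "tail (\<alpha> n) powr (1 - t) * tail \<beta> powr t
        \<le> tail (((1 - t) * \<alpha> n powr s + t * \<beta> powr s) powr (1 / s))"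
      using \<alpha> \<beta> elim tail t by (intro tail_log_concave) auto
    also have "\<dots> \<le> tail (\<beta> * exp (- d))"
    proof (intro finite_measure_mono)
      have "\<beta> * exp (- d) = (t * \<beta> powr s) powr (1 / s)"
        using \<beta> s_pos t by (simp add: powr_mult powr_powr t_def exp_powr_real)
      also have "\<dots> \<le> ((1 - t) * \<alpha> n powr s + t * \<beta> powr s) powr (1 / s)"
        using t s_pos by (intro powr_mono2) auto
      finally show "{x. ((1 - t) * \<alpha> n powr s + t * \<beta> powr s) powr (1 / s) \<le> tukey_depth \<mu> x}
          \<subseteq> {x. \<beta> * exp (- d) \<le> tukey_depth \<mu> x}" by auto
    qed simp
    finally show ?case .
  qed
  moreover have "(\<lambda>n. tail (\<alpha> n) powr (1 - t) * tail \<beta> powr t) \<longlonglongrightarrow> 1 powr (1 - t) * tail \<beta> powr t"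
    using lim by (intro tendsto_intros) auto
  ultimately have "1 powr (1 - t) * tail \<beta> powr t \<le> tail (\<beta> * exp (- d))"
    by (intro tendsto_upperbound[where F = sequentially]) auto
  then show ?thesis by (simp add: t_def)
qed

lemma log_depth_variance_bound: "log_depth_variance_le \<mu> (pi\<^sup>2 / (6 * s\<^sup>2))"
proof -
  let ?Y = "\<lambda>x. - ln (tukey_depth \<mu> x)"
  \<comment> \<open>only almost everywhere: where the depth vanishes, \<open>ln 0 = 0\<close> makes \<open>?Y\<close> zero instead of infinite\<close>
  have cdf: "measure \<mu> {x\<in>space \<mu>. ?Y x \<le> y} = tail (exp (- y))" for y
  proof (rule finite_measure_eq_AE)
    show "AE x in \<mu>. x \<in> {x\<in>space \<mu>. ?Y x \<le> y} \<longleftrightarrow> x \<in> {x. exp (- y) \<le> tukey_depth \<mu> x}"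
      using AE_depth_pos
    proof eventually_elim
      case (elim x)
      then show ?case using ln_ge_iff[OF elim, of "- y"] by (auto simp: minus_le_iff)
    qed
  qed measurable
  have "integrable \<mu> ?Y \<and> integrable \<mu> (\<lambda>x. (?Y x)\<^sup>2) \<and> prob_space.variance \<mu> ?Y \<le> pi\<^sup>2 / (6 * s\<^sup>2)"
  proof (rule variance_le_if_cdf_spread[OF prob_space_axioms _ s_pos])
    fix y d :: real
    assume "0 < d" "0 < measure \<mu> {x\<in>space \<mu>. ?Y x \<le> y}"
    then show "measure \<mu> {x\<in>space \<mu>. ?Y x \<le> y} powr exp (- s * d) \<le> measure \<mu> {x\<in>space \<mu>. ?Y x \<le> y + d}"
      using tail_shrink[of "exp (- y)" d] unfolding cdf by (simp add: exp_add[symmetric])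
  qed measurable
  then show ?thesis
    using AE_depth_pos by (simp add: log_depth_variance_le_def variance_le_def)
qed

end

section \<open>The Brunn-Minkowski inequality on the line\<close>

lemma emeasure_lborel_inner_regular:
  fixes A :: "'a::euclidean_space set"
  assumes A[measurable]: "A \<in> sets borel" and "A \<noteq> {}"
  shows "emeasure lborel A = (SUP K\<in>{K. compact K \<and> K \<subseteq> A \<and> K \<noteq> {}}. emeasure lborel K)"
proof (rule antisym)
  show "emeasure lborel A \<le> (SUP K\<in>{K. compact K \<and> K \<subseteq> A \<and> K \<noteq> {}}. emeasure lborel K)"
  proof (rule dense_le)
    fix z assume z: "z < emeasure lborel A"
    define B where "B n = A \<inter> cball 0 (real n)" for n :: nat
    have [measurable]: "B n \<in> sets borel" for n by (simp add: B_def)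
    have "incseq B"
      by (auto simp: incseq_def B_def)
    moreover have "(\<Union>n. B n) = A"
      using real_arch_simple by (auto simp: B_def)
    ultimately have "(SUP n. emeasure lborel (B n)) = emeasure lborel A"
      using SUP_emeasure_incseq[of B lborel] by (simp add: image_subset_iff)
    with z have "z < (SUP n. emeasure lborel (B n))"
      by simp
    then obtain n where n: "z < emeasure lborel (B n)"
      unfolding less_SUP_iff by blast
    have fin: "emeasure lborel (B n) < \<infinity>"
      by (rule emeasure_bounded_finite) (auto simp: B_def)
    obtain b where b: "emeasure lborel (B n) = ennreal b" "0 \<le> b"
      using fin by (cases "emeasure lborel (B n)") auto
    obtain a where a: "z = ennreal a" "0 \<le> a"
      using n fin by (cases z) auto
    have ab: "a < b" using n a b by (simp add: ennreal_less_iff)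
    obtain T where T: "closed T" "T \<subseteq> B n" "emeasure lebesgue (B n - T) < ennreal (b - a)"
    proof (rule sets_lebesgue_inner_closed[of "B n" "b - a"])
      show "B n \<in> sets lebesgue" by (rule sets_completionI_sets) simp
      show "0 < b - a" using ab by simp
    qed
    have [measurable]: "T \<in> sets borel" using T by auto
    have "T = T \<inter> cball 0 (real n)" using T by (auto simp: B_def)
    then have cT: "compact T" using closed_Int_compact[OF T(1) compact_cball] by metis
    have "ennreal b = emeasure lborel T + emeasure lborel (B n - T)"
      using plus_emeasure[of T lborel "B n - T"] T by (auto simp: b Un_absorb1)
    moreover have "emeasure lborel (B n - T) < ennreal (b - a)"
      using T(3) by (simp add: emeasure_completion)
    ultimately have zT: "z < emeasure lborel T"
      using ab a b
      by (cases "emeasure lborel T"; cases "emeasure lborel (B n - T)")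
         (auto simp: ennreal_less_iff simp flip: ennreal_plus)
    then have "T \<noteq> {}" by auto
    with zT cT T show "z \<le> (SUP K\<in>{K. compact K \<and> K \<subseteq> A \<and> K \<noteq> {}}. emeasure lborel K)"
      by (intro SUP_upper2[of T]) (auto simp: B_def)
  qed
qed (auto intro!: SUP_least emeasure_mono)

lemma emeasure_lborel_scaleR_compact:
  fixes K :: "'a::euclidean_space set"
  assumes "compact K"
  shows "emeasure lborel ((\<lambda>x. c *\<^sub>R x) ` K) = ennreal (\<bar>c\<bar> ^ DIM('a)) * emeasure lborel K"
proof -
  have "compact ((\<lambda>x. c *\<^sub>R x) ` K)"
    by (rule compact_scaling[OF assms])
  then show ?thesis
    using emeasure_lebesgue_affine[of c 0 K] assms
    by (simp add: emeasure_completion borel_compact)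
qed

text \<open>
One-dimensional Brunn-Minkowski inequality. The sumset contains \<open>K + min L\<close> and \<open>max K + L\<close>, translates of
the two sets that lie on either side of the point \<open>max K + min L\<close>.
\<close>

lemma emeasure_sumset_real_compact:
  fixes K L :: "real set"
  assumes K: "compact K" "K \<noteq> {}" and L: "compact L" "L \<noteq> {}" and C: "C \<in> sets borel"
    and sub: "\<And>x y. x \<in> K \<Longrightarrow> y \<in> L \<Longrightarrow> x + y \<in> C"
  shows "emeasure lborel K + emeasure lborel L \<le> emeasure lborel C"
proof -
  obtain k where k: "k \<in> K" "\<And>x. x \<in> K \<Longrightarrow> x \<le> k"
    using compact_attains_sup[OF K] by auto
  obtain l where l: "l \<in> L" "\<And>y. y \<in> L \<Longrightarrow> l \<le> y"
    using compact_attains_inf[OF L] by auto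
  define K' where "K' = (\<lambda>x. x + l) ` K"
  define L' where "L' = (\<lambda>y. y + k) ` L"
  have cpt: "compact K'" "compact L'"
    unfolding K'_def L'_def by (intro compact_continuous_image continuous_intros K L)+
  then have [measurable]: "K' \<in> sets borel" "L' \<in> sets borel"
    by (auto intro: borel_compact)
  have mK: "emeasure lborel K' = emeasure lborel K"
    using emeasure_lebesgue_affine[of 1 l K] K cpt
    by (simp add: emeasure_completion borel_compact flip: K'_def)
  have mL: "emeasure lborel L' = emeasure lborel L"
    using emeasure_lebesgue_affine[of 1 k L] L cpt
    by (simp add: emeasure_completion borel_compact flip: L'_def)
  have "x = k + l" if "x \<in> K'" "x \<in> L'" for x
    using that k l by (force simp: K'_def L'_def)
  then have "K' \<inter> L' \<subseteq> {k + l}" by auto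
  then have "K' \<inter> L' \<in> null_sets lborel"
    by (intro finite_imp_null_set_lborel) (rule finite_subset, auto)
  then have "emeasure lborel (K' \<union> L') = emeasure lborel K' + emeasure lborel L'"
    by (intro emeasure_Un') auto
  moreover have "emeasure lborel (K' \<union> L') \<le> emeasure lborel C"
    using k(1) l(1) sub[of _ l] sub[of k] C
    by (intro emeasure_mono) (auto simp: K'_def L'_def add.commute[of _ k])
  ultimately show ?thesis by (simp add: mK mL)
qed

lemma emeasure_convex_combination_real:
  fixes A B C :: "real set" and t :: real
  assumes A: "A \<in> sets borel" "A \<noteq> {}" and B: "B \<in> sets borel" "B \<noteq> {}" and C: "C \<in> sets borel"
    and t: "0 < t" "t < 1"
    and sub: "\<And>x y. x \<in> A \<Longrightarrow> y \<in> B \<Longrightarrow> (1 - t) * x + t * y \<in> C"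
  shows "ennreal (1 - t) * emeasure lborel A + ennreal t * emeasure lborel B \<le> emeasure lborel C"
proof -
  let ?cA = "{K. compact K \<and> K \<subseteq> A \<and> K \<noteq> {}}" and ?cB = "{K. compact K \<and> K \<subseteq> B \<and> K \<noteq> {}}"
  have ne: "?cA \<noteq> {}" "?cB \<noteq> {}"
  proof -
    obtain a b where "a \<in> A" "b \<in> B" using A B by auto
    then have "{a} \<in> ?cA" "{b} \<in> ?cB" by auto
    then show "?cA \<noteq> {}" "?cB \<noteq> {}" by blast+
  qed
  have "ennreal (1 - t) * emeasure lborel K + ennreal t * emeasure lborel L \<le> emeasure lborel C"
    if K: "K \<in> ?cA" and L: "L \<in> ?cB" for K L
  proof -
    have "emeasure lborel ((\<lambda>x. (1 - t) *\<^sub>R x) ` K) + emeasure lborel ((\<lambda>x. t *\<^sub>R x) ` L) \<le> emeasure lborel C"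
      using K L sub C by (intro emeasure_sumset_real_compact compact_scaling) auto
    then show ?thesis
      using K L t by (simp add: emeasure_lborel_scaleR_compact[of K "1 - t"] emeasure_lborel_scaleR_compact[of L t]
          del: real_scaleR_def)
  qed
  then have "(SUP L\<in>?cB. SUP K\<in>?cA. ennreal (1 - t) * emeasure lborel K + ennreal t * emeasure lborel L)
      \<le> emeasure lborel C"
    by (intro SUP_least) auto
  then show ?thesis
    unfolding emeasure_lborel_inner_regular[OF A] emeasure_lborel_inner_regular[OF B]
      SUP_mult_left_ennreal ennreal_SUP_add_right[OF ne(2)] ennreal_SUP_add_left[OF ne(1), symmetric] .
qed

section \<open>The Prekopa-Leindler inequality on the line\<close>

lemma nn_integral_layer_cake:
  fixes u :: "'a \<Rightarrow> ennreal"
  assumes M: "sigma_finite_measure M" and u[measurable]: "u \<in> borel_measurable M"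
  shows "(\<integral>\<^sup>+x. u x \<partial>M) = (\<integral>\<^sup>+l. indicator {0..} l * emeasure M {x\<in>space M. ennreal l < u x} \<partial>lborel)"
proof -
  interpret sigma_finite_measure M by (rule M)
  interpret pair_sigma_finite lborel M by standard
  have ray: "u x = (\<integral>\<^sup>+l. indicator {l. 0 \<le> l \<and> ennreal l < u x} l \<partial>lborel)" for x
  proof (cases "u x")
    case (real r)
    then have "{l. 0 \<le> l \<and> ennreal l < u x} = {0..<r}"
      by (auto simp: ennreal_less_iff)
    then show ?thesis using real by simp
  next
    case top
    have "emeasure lborel {0::real..} = \<infinity>"
    proof (cases "emeasure lborel {0::real..}")
      case (real r)
      have "emeasure lborel {0..r + 1} \<le> emeasure lborel {0::real..}"
        by (intro emeasure_mono) auto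
      then show ?thesis using real by simp
    qed simp
    then show ?thesis using top by (simp add: atLeast_def)
  qed
  have "(\<integral>\<^sup>+x. u x \<partial>M) = (\<integral>\<^sup>+x. \<integral>\<^sup>+l. indicator {l. 0 \<le> l \<and> ennreal l < u x} l \<partial>lborel \<partial>M)"
    by (intro nn_integral_cong ray)
  also have "\<dots> = (\<integral>\<^sup>+l. \<integral>\<^sup>+x. indicator {l. 0 \<le> l \<and> ennreal l < u x} l \<partial>M \<partial>lborel)"
    by (rule Fubini') measurable
  also have "\<dots> = (\<integral>\<^sup>+l. indicator {0..} l * emeasure M {x\<in>space M. ennreal l < u x} \<partial>lborel)"
  proof (rule nn_integral_cong)
    fix l :: real
    have "(\<integral>\<^sup>+x. indicator {l. 0 \<le> l \<and> ennreal l < u x} l \<partial>M)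
        = (\<integral>\<^sup>+x. indicator {0..} l * indicator {x\<in>space M. ennreal l < u x} x \<partial>M)"
      by (intro nn_integral_cong) (auto split: split_indicator)
    then show "(\<integral>\<^sup>+x. indicator {l. 0 \<le> l \<and> ennreal l < u x} l \<partial>M)
        = indicator {0..} l * emeasure M {x\<in>space M. ennreal l < u x}"
      by (simp add: nn_integral_cmult)
  qed
  finally show ?thesis .
qed

text \<open>
The inequality \<open>u powr (1 - t) * v powr t \<le> w\<close> for extended nonnegative numbers, stated through all finite
positive lower bounds of \<open>u\<close> and \<open>v\<close>. This fixes the meaning at 0 and at infinity, and the
Prekopa-Leindler inequality takes the same form in its hypothesis and its conclusion, so that it
can be applied to one coordinate after the other.
\<close>

definition geometric_mean_le :: "real \<Rightarrow> ennreal \<Rightarrow> ennreal \<Rightarrow> ennreal \<Rightarrow> bool" where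
  "geometric_mean_le t u v w \<longleftrightarrow>
     (\<forall>a>0. \<forall>b>0. ennreal a \<le> u \<longrightarrow> ennreal b \<le> v \<longrightarrow> ennreal (a powr (1 - t) * b powr t) \<le> w)"

lemma geometric_mean_leD:
  "geometric_mean_le t u v w \<Longrightarrow> 0 < a \<Longrightarrow> 0 < b \<Longrightarrow> ennreal a \<le> u \<Longrightarrow> ennreal b \<le> v \<Longrightarrow>
    ennreal (a powr (1 - t) * b powr t) \<le> w"
  by (auto simp: geometric_mean_le_def)

lemma ennreal_divide_le_iff_le_mult:
  assumes "0 < c"
  shows "ennreal a \<le> ennreal c * u \<longleftrightarrow> ennreal (a / c) \<le> u"
proof (cases u)
  case (real r)
  then show ?thesis
    using assms by (cases "0 \<le> a") (auto simp: ennreal_mult'[symmetric] ennreal_le_iff2 field_simps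
      ennreal_neg divide_nonpos_pos)
qed (use assms in \<open>auto simp: ennreal_mult_top\<close>)

lemma geometric_mean_le_scale:
  assumes "geometric_mean_le t u v w" and c: "0 < c" and d: "0 < d"
  shows "geometric_mean_le t (ennreal c * u) (ennreal d * v) (ennreal (c powr (1 - t) * d powr t) * w)"
  unfolding geometric_mean_le_def
proof (intro allI impI)
  fix a b :: real
  assume a: "0 < a" "ennreal a \<le> ennreal c * u" and b: "0 < b" "ennreal b \<le> ennreal d * v"
  have "ennreal ((a / c) powr (1 - t) * (b / d) powr t) \<le> w"
    using a b c d by (intro geometric_mean_leD[OF assms(1)]) (auto simp: ennreal_divide_le_iff_le_mult)
  moreover have "(a / c) powr (1 - t) * (b / d) powr t
      = (a powr (1 - t) * b powr t) / (c powr (1 - t) * d powr t)"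
    using a b c d by (simp add: powr_divide)
  ultimately show "ennreal (a powr (1 - t) * b powr t) \<le> ennreal (c powr (1 - t) * d powr t) * w"
    using c d by (subst ennreal_divide_le_iff_le_mult) auto
qed

text \<open>
When \<open>f\<close> and \<open>g\<close> both have supremum 1, their superlevel sets are nonempty for exactly the same levels
\<open>l < 1\<close>. At these levels the one-dimensional Brunn-Minkowski inequality bounds the superlevel set of \<open>h\<close> from below;
integration over \<open>l\<close> gives a conclusion with the arithmetic mean in place of the geometric one.
\<close>

lemma prekopa_leindler_real_normalized:
  fixes f g h :: "real \<Rightarrow> ennreal"
  assumes [measurable]: "f \<in> borel_measurable borel" "g \<in> borel_measurable borel" "h \<in> borel_measurable borel"
    and t: "0 < t" "t < 1"
    and F: "(SUP x. f x) = 1" and G: "(SUP x. g x) = 1"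
    and fgh: "\<And>x y. geometric_mean_le t (f x) (g y) (h ((1 - t) * x + t * y))"
  shows "ennreal (1 - t) * (\<integral>\<^sup>+x. f x \<partial>lborel) + ennreal t * (\<integral>\<^sup>+x. g x \<partial>lborel) \<le> (\<integral>\<^sup>+x. h x \<partial>lborel)"
proof -
  let ?E = "\<lambda>f (l::real). emeasure lborel {x\<in>space lborel. ennreal l < f (x::real)}"
  have level: "ennreal (1 - t) * ?E f l + ennreal t * ?E g l \<le> ?E h l" if l: "0 \<le> l" for l
  proof (cases "l < 1")
    case True
    then have "ennreal l < (SUP x. f x)" "ennreal l < (SUP x. g x)"
      using F G l by (auto simp: ennreal_less_one_iff)
    then have ne: "{x. ennreal l < f x} \<noteq> {}" "{x. ennreal l < g x} \<noteq> {}"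
      by (auto simp: less_SUP_iff)
    have "ennreal l < h ((1 - t) * x + t * y)" if xy: "ennreal l < f x" "ennreal l < g y" for x y
    proof -
      have "ennreal l < min (f x) (g y)" using xy by simp
      then obtain z where z: "ennreal l < z" "z < min (f x) (g y)"
        using dense by blast
      then obtain c where c: "z = ennreal c" "0 \<le> c"
        by (cases z) auto
      have "l < c" using z c l by (simp add: ennreal_less_iff)
      then have "ennreal (c powr (1 - t) * c powr t) \<le> h ((1 - t) * x + t * y)"
        using z c l by (intro geometric_mean_leD[OF fgh]) auto
      then show ?thesis
        using z c \<open>l < c\<close> l by (auto simp: powr_add[symmetric])
    qed
    then show ?thesis
      using ne t by (intro emeasure_convex_combination_real) auto
  next
    case False
    then have "ennreal 1 \<le> ennreal l" by (intro ennreal_leI) simp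
    then have "\<not> ennreal l < f x" "\<not> ennreal l < g x" for x
      using SUP_upper[of x UNIV f] SUP_upper[of x UNIV g] F G
      by (auto simp: not_less intro: order_trans)
    then show ?thesis by simp
  qed
  have cake: "(\<integral>\<^sup>+x. k x \<partial>lborel) = (\<integral>\<^sup>+l. indicator {0..} l * ?E k l \<partial>lborel)"
    if "k \<in> borel_measurable borel" for k :: "real \<Rightarrow> ennreal"
    using that by (intro nn_integral_layer_cake lborel.sigma_finite_measure_axioms) simp
  have meas: "?E k \<in> borel_measurable borel" if [measurable]: "k \<in> borel_measurable borel" for k
  proof -
    have "?E k = (\<lambda>l. \<integral>\<^sup>+x. indicator {x. ennreal l < k x} x \<partial>lborel)"
      by (intro ext) simp
    also have "\<dots> \<in> borel_measurable borel"
      by measurable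
    finally show ?thesis .
  qed
  note [measurable] = meas[OF assms(1)] meas[OF assms(2)]
  have "ennreal (1 - t) * (\<integral>\<^sup>+x. f x \<partial>lborel) + ennreal t * (\<integral>\<^sup>+x. g x \<partial>lborel)
      = (\<integral>\<^sup>+l. ennreal (1 - t) * (indicator {0..} l * ?E f l) + ennreal t * (indicator {0..} l * ?E g l) \<partial>lborel)"
    unfolding cake[OF assms(1)] cake[OF assms(2)] by (simp add: nn_integral_add nn_integral_cmult)
  also have "\<dots> \<le> (\<integral>\<^sup>+l. indicator {0..} l * ?E h l \<partial>lborel)"
    using level by (intro nn_integral_mono) (auto split: split_indicator)
  also have "\<dots> = (\<integral>\<^sup>+x. h x \<partial>lborel)"
    by (rule cake[OF assms(3), symmetric])
  finally show ?thesis .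
qed

text \<open>
Dividing \<open>f\<close> and \<open>g\<close> by their suprema reduces to the normalised case. The hypothesis scales with the geometric mean,
which turns the arithmetic mean of the conclusion back into a geometric one.
\<close>

lemma prekopa_leindler_real_bounded:
  fixes f g h :: "real \<Rightarrow> ennreal"
  assumes [measurable]: "f \<in> borel_measurable borel" "g \<in> borel_measurable borel" "h \<in> borel_measurable borel"
    and t: "0 < t" "t < 1"
    and bdd: "\<And>x. f x \<le> ennreal m" "\<And>x. g x \<le> ennreal m"
    and fgh: "\<And>x y. geometric_mean_le t (f x) (g y) (h ((1 - t) * x + t * y))"
  shows "geometric_mean_le t (\<integral>\<^sup>+x. f x \<partial>lborel) (\<integral>\<^sup>+x. g x \<partial>lborel) (\<integral>\<^sup>+x. h x \<partial>lborel)"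
  unfolding geometric_mean_le_def
proof (intro allI impI)
  fix a b :: real
  assume a: "0 < a" "ennreal a \<le> (\<integral>\<^sup>+x. f x \<partial>lborel)" and b: "0 < b" "ennreal b \<le> (\<integral>\<^sup>+x. g x \<partial>lborel)"
  have pos: "\<exists>r>0. (SUP x. k x) = ennreal r"
    if k: "\<And>x. k x \<le> ennreal m" "0 < c" "ennreal c \<le> (\<integral>\<^sup>+x. k x \<partial>lborel)" for k :: "real \<Rightarrow> ennreal" and c
  proof -
    have "(SUP x. k x) \<le> ennreal m"
      using k by (intro SUP_least)
    then obtain r where r: "(SUP x. k x) = ennreal r" "0 \<le> r"
      by (cases "SUP x. k x") (auto simp: top_unique)
    have "r \<noteq> 0"
    proof
      assume "r = 0"
      then have "k x \<le> 0" for x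
        using SUP_upper[of x UNIV k] r by simp
      then have "(\<integral>\<^sup>+x. k x \<partial>lborel) = 0" by simp
      then show False using k by simp
    qed
    then show ?thesis using r by (intro exI[of _ r]) auto
  qed
  obtain F where F: "0 < F" "(SUP x. f x) = ennreal F" using pos[OF bdd(1) a] by blast
  obtain G where G: "0 < G" "(SUP x. g x) = ennreal G" using pos[OF bdd(2) b] by blast
  define H where "H = (1 / F) powr (1 - t) * (1 / G) powr t"
  have H: "H > 0" using F G by (simp add: H_def)
  have "ennreal (1 - t) * (\<integral>\<^sup>+x. ennreal (1 / F) * f x \<partial>lborel) + ennreal t * (\<integral>\<^sup>+x. ennreal (1 / G) * g x \<partial>lborel)
      \<le> (\<integral>\<^sup>+x. ennreal H * h x \<partial>lborel)"
  proof (rule prekopa_leindler_real_normalized[OF _ _ _ t])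
    show "(SUP x. ennreal (1 / F) * f x) = 1" "(SUP x. ennreal (1 / G) * g x) = 1"
      using F G by (simp_all add: SUP_mult_left_ennreal[symmetric] ennreal_mult'[symmetric])
    show "geometric_mean_le t (ennreal (1 / F) * f x) (ennreal (1 / G) * g y) (ennreal H * h ((1 - t) * x + t * y))" for x y
      unfolding H_def using F G by (intro geometric_mean_le_scale fgh) auto
  qed simp_all
  also have "\<dots> = ennreal H * (\<integral>\<^sup>+x. h x \<partial>lborel)"
    by (simp add: nn_integral_cmult)
  finally have *: "ennreal (1 - t) * (ennreal (1 / F) * (\<integral>\<^sup>+x. f x \<partial>lborel))
      + ennreal t * (ennreal (1 / G) * (\<integral>\<^sup>+x. g x \<partial>lborel)) \<le> ennreal H * (\<integral>\<^sup>+x. h x \<partial>lborel)"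
    by (simp add: nn_integral_cmult)
  have "H * (a powr (1 - t) * b powr t) = (a / F) powr (1 - t) * (b / G) powr t"
    using a b F G by (simp add: H_def powr_divide)
  also have "\<dots> \<le> (1 - t) * (a / F) + t * (b / G)"
    using a b F G t by (intro Youngs_inequality_0) auto
  finally have "ennreal (H * (a powr (1 - t) * b powr t)) \<le> ennreal ((1 - t) * (a / F) + t * (b / G))"
    by (rule ennreal_leI)
  also have "\<dots> = ennreal (1 - t) * (ennreal (1 / F) * ennreal a) + ennreal t * (ennreal (1 / G) * ennreal b)"
    using a b F G t by (simp add: ennreal_mult'[symmetric] ennreal_plus[symmetric] del: ennreal_plus)
  also have "\<dots> \<le> ennreal (1 - t) * (ennreal (1 / F) * (\<integral>\<^sup>+x. f x \<partial>lborel))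
      + ennreal t * (ennreal (1 / G) * (\<integral>\<^sup>+x. g x \<partial>lborel))"
    using a b by (intro add_mono mult_left_mono) auto
  also note *
  finally show "ennreal (a powr (1 - t) * b powr t) \<le> (\<integral>\<^sup>+x. h x \<partial>lborel)"
    using H by (simp add: ennreal_divide_le_iff_le_mult)
qed

text \<open>
Truncation at height \<open>k\<close> keeps the hypothesis, and by monotone convergence the truncated integrals exceed \<open>z * a\<close>
and \<open>z * b\<close> for any \<open>z < 1\<close>. Both factors \<open>z\<close> together contribute \<open>z powr (1 - t) * z powr t = z\<close>.
\<close>

lemma prekopa_leindler_real:
  fixes f g h :: "real \<Rightarrow> ennreal"
  assumes [measurable]: "f \<in> borel_measurable borel" "g \<in> borel_measurable borel" "h \<in> borel_measurable borel"
    and t: "0 < t" "t < 1"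
    and fgh: "\<And>x y. geometric_mean_le t (f x) (g y) (h ((1 - t) * x + t * y))"
  shows "geometric_mean_le t (\<integral>\<^sup>+x. f x \<partial>lborel) (\<integral>\<^sup>+x. g x \<partial>lborel) (\<integral>\<^sup>+x. h x \<partial>lborel)"
  unfolding geometric_mean_le_def
proof (intro allI impI)
  fix a b :: real
  assume a: "0 < a" "ennreal a \<le> (\<integral>\<^sup>+x. f x \<partial>lborel)" and b: "0 < b" "ennreal b \<le> (\<integral>\<^sup>+x. g x \<partial>lborel)"
  have trunc: "\<exists>n. \<forall>k\<ge>n. ennreal (z * c) \<le> (\<integral>\<^sup>+x. min (p x) (ennreal (real k)) \<partial>lborel)"
    if z: "0 < z" "z < 1" and c: "0 < c" "ennreal c \<le> (\<integral>\<^sup>+x. p x \<partial>lborel)"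
      and p[measurable]: "p \<in> borel_measurable borel" for p :: "real \<Rightarrow> ennreal" and z c
  proof -
    have mono: "incseq (\<lambda>k x. min (p x) (ennreal (real k)))"
      unfolding incseq_def le_fun_def by (intro allI impI min.mono ennreal_leI) auto
    have "(SUP k. min (p x) (ennreal (real k))) = p x" for x
    proof -
      have "(SUP k. min (p x) (ennreal (real k))) = min (p x) (SUP k. ennreal (real k))"
        by (simp add: inf_SUP flip: inf_min)
      also have "(SUP k. ennreal (real k)) = \<infinity>"
        using ennreal_SUP_of_nat_eq_top by (simp add: ennreal_of_nat_eq_real_of_nat)
      finally show ?thesis by simp
    qed
    then have "(\<integral>\<^sup>+x. p x \<partial>lborel) = (SUP k. \<integral>\<^sup>+x. min (p x) (ennreal (real k)) \<partial>lborel)"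
      using nn_integral_monotone_convergence_SUP[OF mono, of lborel] by simp
    moreover have "ennreal (z * c) < ennreal c"
      using z c by (intro ennreal_lessI) auto
    ultimately obtain n where n: "ennreal (z * c) < (\<integral>\<^sup>+x. min (p x) (ennreal (real n)) \<partial>lborel)"
      using c(2) by (metis (no_types, lifting) less_SUP_iff order_less_le_trans)
    have "ennreal (z * c) \<le> (\<integral>\<^sup>+x. min (p x) (ennreal (real k)) \<partial>lborel)" if "n \<le> k" for k
    proof -
      have "(\<integral>\<^sup>+x. min (p x) (ennreal (real n)) \<partial>lborel) \<le> (\<integral>\<^sup>+x. min (p x) (ennreal (real k)) \<partial>lborel)"
        using that by (intro nn_integral_mono min.mono ennreal_leI) auto
      with n show ?thesis by simp
    qed
    then show ?thesis by blast
  qed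
  let ?P = "a powr (1 - t) * b powr t"
  have shrunk: "ennreal (z * ?P) \<le> (\<integral>\<^sup>+x. h x \<partial>lborel)" if z: "0 < z" "z < 1" for z
  proof -
    obtain n1 where n1: "\<And>k. n1 \<le> k \<Longrightarrow> ennreal (z * a) \<le> (\<integral>\<^sup>+x. min (f x) (ennreal (real k)) \<partial>lborel)"
      using trunc[OF z a] by auto
    obtain n2 where n2: "\<And>k. n2 \<le> k \<Longrightarrow> ennreal (z * b) \<le> (\<integral>\<^sup>+x. min (g x) (ennreal (real k)) \<partial>lborel)"
      using trunc[OF z b] by auto
    define k where "k = max n1 n2"
    have "geometric_mean_le t (\<integral>\<^sup>+x. min (f x) (ennreal (real k)) \<partial>lborel)
        (\<integral>\<^sup>+x. min (g x) (ennreal (real k)) \<partial>lborel) (\<integral>\<^sup>+x. h x \<partial>lborel)"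
    proof (rule prekopa_leindler_real_bounded[OF _ _ _ t, where m = "real k"])
      show "geometric_mean_le t (min (f x) (ennreal (real k))) (min (g y) (ennreal (real k)))
          (h ((1 - t) * x + t * y))" for x y
        using fgh[of x y] by (auto simp: geometric_mean_le_def)
    qed auto
    then have "ennreal ((z * a) powr (1 - t) * (z * b) powr t) \<le> (\<integral>\<^sup>+x. h x \<partial>lborel)"
      using n1[of k] n2[of k] a b z by (intro geometric_mean_leD) (auto simp: k_def)
    moreover have "(z * a) powr (1 - t) * (z * b) powr t = (z powr (1 - t) * z powr t) * ?P"
      using a b z by (simp add: powr_mult)
    ultimately show ?thesis
      using z by (simp add: powr_add[symmetric])
  qed
  show "ennreal ?P \<le> (\<integral>\<^sup>+x. h x \<partial>lborel)"
  proof (cases "\<integral>\<^sup>+x. h x \<partial>lborel")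
    case (real r)
    have "?P \<le> r"
    proof (rule field_le_mult_one_interval)
      fix z :: real assume "0 < z" "z < 1"
      then have "ennreal (z * ?P) \<le> ennreal r"
        using shrunk real by simp
      then show "z * ?P \<le> r"
        using real by (simp add: ennreal_le_iff)
    qed
    then show ?thesis using real by (auto intro: ennreal_leI)
  qed simp
qed

section \<open>The Brunn-Minkowski inequality in Euclidean space\<close>

text \<open>
Induction on the number of coordinates: for fixed \<open>x\<close> and \<open>y\<close> in the remaining coordinates, the one-dimensional inequality
applied to the fibres says that the marginals satisfy the hypothesis in one dimension less.
\<close>

lemma prekopa_leindler_PiM:
  fixes f g h :: "('i \<Rightarrow> real) \<Rightarrow> ennreal" and t :: real
  defines "P \<equiv> \<lambda>I. PiM I (\<lambda>_::'i. lborel :: real measure)"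
  assumes "finite I" and t: "0 < t" "t < 1"
    and "f \<in> borel_measurable (P I)" "g \<in> borel_measurable (P I)" "h \<in> borel_measurable (P I)"
    and "\<And>x y. x \<in> space (P I) \<Longrightarrow> y \<in> space (P I) \<Longrightarrow>
      geometric_mean_le t (f x) (g y) (h (\<lambda>i\<in>I. (1 - t) * x i + t * y i))"
  shows "geometric_mean_le t (\<integral>\<^sup>+x. f x \<partial>P I) (\<integral>\<^sup>+x. g x \<partial>P I) (\<integral>\<^sup>+x. h x \<partial>P I)"
  using assms(2,5-)
proof (induction I arbitrary: f g h rule: finite_induct)
  case empty
  interpret product_sigma_finite "\<lambda>_. lborel" ..
  have "(\<lambda>k. undefined) \<in> space (P {})" by (simp add: P_def)
  from empty.prems(4)[OF this this] show ?case
    by (simp add: P_def product_sigma_finite.nn_integral_empty[OF product_sigma_finite_axioms] restrict_def)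
next
  case (insert i I)
  interpret product_sigma_finite "\<lambda>_::'i. lborel :: real measure" ..
  note [measurable] = insert.prems(1-3)[unfolded P_def]
  have sp: "x(i := z) \<in> space (P (insert i I))" if "x \<in> space (P I)" for x z
    using that by (auto simp: P_def space_PiM PiE_def extensional_def)
  have fiber[measurable]: "(\<lambda>z. k (x(i := z))) \<in> borel_measurable borel"
    if "k \<in> borel_measurable (P (insert i I))" "x \<in> space (P I)" for k :: "('i \<Rightarrow> real) \<Rightarrow> ennreal" and x
  proof -
    have "(\<lambda>z. x(i := z)) \<in> lborel \<rightarrow>\<^sub>M P (insert i I)"
      using that(2) unfolding P_def by (intro measurable_fun_upd[where J = I]) auto
    then have "(\<lambda>z. k (x(i := z))) \<in> borel_measurable lborel"
      using that(1) by (rule measurable_compose)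
    then show ?thesis by simp
  qed
  have split: "(\<integral>\<^sup>+x. k x \<partial>P (insert i I)) = (\<integral>\<^sup>+x. \<integral>\<^sup>+z. k (x(i := z)) \<partial>lborel \<partial>P I)"
    if "k \<in> borel_measurable (P (insert i I))" for k
    using product_nn_integral_insert[OF insert.hyps, of k] that by (simp add: P_def)
  have marginal: "(\<lambda>x. \<integral>\<^sup>+z. k (x(i := z)) \<partial>lborel) \<in> borel_measurable (P I)"
    if "k \<in> borel_measurable (P (insert i I))" for k :: "('i \<Rightarrow> real) \<Rightarrow> ennreal"
  proof (rule lborel.borel_measurable_nn_integral)
    have "(\<lambda>(x, z). x(i := z)) \<in> P I \<Otimes>\<^sub>M lborel \<rightarrow>\<^sub>M P (insert i I)"
      unfolding P_def by (rule measurable_add_dim)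
    from measurable_compose[OF this that]
    show "(\<lambda>(x, z). k (x(i := z))) \<in> borel_measurable (P I \<Otimes>\<^sub>M lborel)"
      by (simp add: case_prod_unfold)
  qed
  show ?case
    unfolding split[OF insert.prems(1)] split[OF insert.prems(2)] split[OF insert.prems(3)]
  proof (rule insert.IH[OF marginal marginal marginal])
    fix x y assume x: "x \<in> space (P I)" and y: "y \<in> space (P I)"
    let ?w = "\<lambda>j\<in>I. (1 - t) * x j + t * y j"
    have w: "?w \<in> space (P I)"
      by (auto simp: P_def space_PiM)
    show "geometric_mean_le t (\<integral>\<^sup>+z. f (x(i := z)) \<partial>lborel) (\<integral>\<^sup>+z. g (y(i := z)) \<partial>lborel)
        (\<integral>\<^sup>+z. h (?w(i := z)) \<partial>lborel)"
    proof (rule prekopa_leindler_real[OF _ _ _ t])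
      fix u v :: real
      have "(\<lambda>j\<in>insert i I. (1 - t) * (x(i := u)) j + t * (y(i := v)) j) = ?w(i := (1 - t) * u + t * v)"
        using insert.hyps by (auto simp: fun_eq_iff restrict_def)
      then show "geometric_mean_le t (f (x(i := u))) (g (y(i := v))) (h (?w(i := (1 - t) * u + t * v)))"
        using insert.prems(4)[OF sp[OF x, of u] sp[OF y, of v]] by (simp only:)
    qed (rule fiber insert.prems x y w)+
  qed (rule insert.prems)+
qed

text \<open>
The Prekopa-Leindler inequality for indicator functions, transported along the description of Lebesgue measure as a
product measure over an orthonormal basis.
\<close>

lemma multiplicative_brunn_minkowski:
  fixes A B C :: "'a::euclidean_space set"
  assumes [measurable]: "A \<in> sets borel" "B \<in> sets borel" "C \<in> sets borel"
    and t: "0 < t" "t < 1"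
    and sub: "\<And>x y. x \<in> A \<Longrightarrow> y \<in> B \<Longrightarrow> (1 - t) *\<^sub>R x + t *\<^sub>R y \<in> C"
  shows "geometric_mean_le t (emeasure lborel A) (emeasure lborel B) (emeasure lborel C)"
proof -
  let ?P = "PiM (Basis :: 'a set) (\<lambda>_. lborel :: real measure)"
  define vec :: "('a \<Rightarrow> real) \<Rightarrow> 'a" where "vec = (\<lambda>x. \<Sum>b\<in>Basis. x b *\<^sub>R b)"
  have [measurable]: "vec \<in> ?P \<rightarrow>\<^sub>M borel"
    unfolding vec_def by measurable
  have emeasure_eq: "emeasure lborel S = (\<integral>\<^sup>+x. indicator S (vec x) \<partial>?P)" if [measurable]: "S \<in> sets borel" for S
  proof -
    have "emeasure lborel S = (\<integral>\<^sup>+x. indicator S x \<partial>distr ?P borel vec)"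
      unfolding vec_def lborel_eq[symmetric] by (rule nn_integral_indicator[symmetric]) simp
    then show ?thesis by (simp add: nn_integral_distr del: nn_integral_indicator)
  qed
  show ?thesis
    unfolding emeasure_eq[OF assms(1)] emeasure_eq[OF assms(2)] emeasure_eq[OF assms(3)]
  proof (rule prekopa_leindler_PiM[OF finite_Basis t])
    fix x y :: "'a \<Rightarrow> real"
    have vec: "vec (\<lambda>i\<in>Basis. (1 - t) * x i + t * y i) = (1 - t) *\<^sub>R vec x + t *\<^sub>R vec y"
      by (simp add: vec_def scaleR_sum_right sum.distrib[symmetric] scaleR_add_left)
    show "geometric_mean_le t (indicator A (vec x)) (indicator B (vec y))
        (indicator C (vec (\<lambda>i\<in>Basis. (1 - t) * x i + t * y i)))"
      unfolding geometric_mean_le_def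
    proof (intro allI impI)
      fix a b :: real
      assume a: "0 < a" "ennreal a \<le> indicator A (vec x)" and b: "0 < b" "ennreal b \<le> indicator B (vec y)"
      then have mem: "vec x \<in> A" "vec y \<in> B"
        by (auto simp: indicator_def of_bool_def split: if_splits)
      with a b have "a \<le> 1" "b \<le> 1" by auto
      then have "a powr (1 - t) * b powr t \<le> 1"
        using a b t by (intro mult_le_one powr_le1) auto
      then show "ennreal (a powr (1 - t) * b powr t)
          \<le> indicator C (vec (\<lambda>i\<in>Basis. (1 - t) * x i + t * y i))"
        using sub[OF mem] by (simp add: vec)
    qed
  qed measurable
qed

text \<open>
The additive form follows from the multiplicative one by homogeneity: \<open>A\<close> and \<open>B\<close> are rescaled to volume 1, and the
weight \<open>t\<close> is changed to \<open>r\<close>, for which the combination of the rescaled sets is \<open>(1 / S) ((1 - t) A + t B)\<close>.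
\<close>

lemma brunn_minkowski_compact:
  fixes A B :: "'a::euclidean_space set"
  assumes A: "compact A" "0 < measure lborel A" and B: "compact B" "0 < measure lborel B"
    and t: "0 < t" "t < 1" and C: "compact C"
    and sub: "\<And>x y. x \<in> A \<Longrightarrow> y \<in> B \<Longrightarrow> (1 - t) *\<^sub>R x + t *\<^sub>R y \<in> C"
  defines "p \<equiv> 1 / real DIM('a)"
  shows "(1 - t) * measure lborel A powr p + t * measure lborel B powr p \<le> measure lborel C powr p"
proof -
  define n where "n = DIM('a)"
  have n: "0 < n" by (simp add: n_def)
  have scale: "measure lborel ((\<lambda>x. c *\<^sub>R x) ` K) = c ^ n * measure lborel K" if "compact K" "0 \<le> c" for K :: "'a set" and c
    using emeasure_lborel_scaleR_compact[OF that(1), of c] that(2) by (simp add: measure_def enn2real_mult n_def)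
  have root: "(x powr p) ^ n = x" if "0 < x" for x
    using that n by (simp add: p_def n_def[symmetric] powr_powr flip: powr_realpow)
  define a b where "a = measure lborel A powr p" and "b = measure lborel B powr p"
  have ab: "0 < a" "0 < b" using A B by (simp_all add: a_def b_def)
  define S where "S = (1 - t) * a + t * b"
  have S: "0 < S" using ab t by (simp add: S_def add_pos_pos)
  define r where "r = t * b / S"
  have r: "0 < r" "r < 1"
    using ab t S by (auto simp: r_def S_def)
  have r1: "1 - r = (1 - t) * a / S"
    using S by (simp add: r_def S_def field_simps)
  define A' B' C' where "A' = (\<lambda>x. (1 / a) *\<^sub>R x) ` A" and "B' = (\<lambda>x. (1 / b) *\<^sub>R x) ` B"
    and "C' = (\<lambda>x. (1 / S) *\<^sub>R x) ` C"
  have cpt: "compact A'" "compact B'" "compact C'"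
    unfolding A'_def B'_def C'_def by (intro compact_scaling A B C)+
  have m: "measure lborel A' = 1" "measure lborel B' = 1"
    using ab A B root[of "measure lborel A"] root[of "measure lborel B"]
    by (auto simp: A'_def B'_def scale power_divide a_def b_def)
  have em: "emeasure lborel K = ennreal (measure lborel K)" if "compact K" for K :: "'a set"
    using that by (intro emeasure_eq_ennreal_measure) (use emeasure_compact_finite[of K] in auto)
  have "geometric_mean_le r (emeasure lborel A') (emeasure lborel B') (emeasure lborel C')"
  proof (rule multiplicative_brunn_minkowski[OF _ _ _ r])
    fix x y assume "x \<in> A'" "y \<in> B'"
    then obtain u v where uv: "u \<in> A" "v \<in> B" "x = (1 / a) *\<^sub>R u" "y = (1 / b) *\<^sub>R v"
      by (auto simp: A'_def B'_def)
    have "(1 - r) *\<^sub>R x + r *\<^sub>R y = (1 / S) *\<^sub>R ((1 - t) *\<^sub>R u + t *\<^sub>R v)"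
      unfolding r1 using ab S by (simp add: uv r_def scaleR_add_right)
    then show "(1 - r) *\<^sub>R x + r *\<^sub>R y \<in> C'"
      using sub[OF uv(1,2)] by (auto simp: C'_def)
  qed (use cpt borel_compact in auto)
  from geometric_mean_leD[OF this, of 1 1] have "1 \<le> measure lborel C'"
    using m by (simp add: em cpt)
  then have "S ^ n \<le> measure lborel C"
    using S C by (simp add: C'_def scale field_simps)
  then have "(S ^ n) powr p \<le> measure lborel C powr p"
    using S n by (intro powr_mono2) (auto simp: p_def)
  moreover have "(S ^ n) powr p = S"
    using S n by (simp add: p_def n_def[symmetric] powr_powr flip: powr_realpow)
  ultimately show ?thesis by (simp add: S_def a_def b_def)
qed

section \<open>Uniform measures on convex bodies\<close>

lemma convex_body_measure_pos:
  assumes "convex_body K"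
  shows "0 < measure lborel K" "emeasure lborel K < \<infinity>"
proof -
  show fin: "emeasure lborel K < \<infinity>"
    using assms emeasure_compact_finite[of K] by (simp add: convex_body_def)
  have "\<not> negligible (interior K)"
    using assms by (intro open_not_negligible) (auto simp: convex_body_def)
  then have "\<not> negligible K"
    using interior_subset negligible_subset by blast
  then have "emeasure lborel K \<noteq> 0"
    using assms unfolding negligible_iff_null_sets convex_body_def
    by (auto simp: null_sets_def emeasure_completion borel_compact)
  with fin show "0 < measure lborel K"
    unfolding measure_def by (simp add: enn2real_positive_iff zero_less_iff_neq_zero)
qed

lemma measure_uniform_measure_body:
  assumes "convex_body K" "A \<in> sets borel"
  shows "measure (uniform_measure lborel K) A = measure lborel (K \<inter> A) / measure lborel K"
proof (rule measure_uniform_measure)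
  show "emeasure lborel K \<noteq> 0"
    using convex_body_measure_pos[OF assms(1)] by (auto simp: measure_def)
  show "emeasure lborel K \<noteq> \<infinity>"
    using convex_body_measure_pos[OF assms(1)] by auto
qed (use assms in simp)

lemma prob_space_uniform_measure_body:
  assumes "convex_body K"
  shows "prob_space (uniform_measure lborel K)"
  using convex_body_measure_pos[OF assms] by (intro prob_space_uniform_measure) (auto simp: measure_def)

lemma convex_combination_set_eq_image:
  "{(1 - t) *\<^sub>R a + t *\<^sub>R b | a b. a \<in> A \<and> b \<in> B} = (\<lambda>(a, b). (1 - t) *\<^sub>R a + t *\<^sub>R b) ` (A \<times> B)"
  by auto

lemma compact_convex_combination:
  fixes A B :: "'a::real_normed_vector set"
  assumes "compact A" "compact B"
  shows "compact {(1 - t) *\<^sub>R a + t *\<^sub>R b | a b. a \<in> A \<and> b \<in> B}"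
  unfolding convex_combination_set_eq_image case_prod_unfold
  by (intro compact_continuous_image compact_Times assms continuous_intros)

text \<open>
The Brunn-Minkowski inequality for \<open>K \<inter> A\<close> and \<open>K \<inter> B\<close>, whose convex combinations stay in \<open>K\<close>.
\<close>

lemma uniform_measure_s_concave:
  fixes K :: "'a::euclidean_space set"
  assumes K: "convex_body K"
  shows "s_concave (1 / real DIM('a)) (uniform_measure lborel K)"
proof -
  let ?\<mu> = "uniform_measure lborel K" and ?p = "1 / real DIM('a)"
  have cK: "compact K" "convex K" "interior K \<noteq> {}"
    using K by (auto simp: convex_body_def)
  have [measurable]: "K \<in> sets borel" using cK by (intro borel_compact)
  define v where "v = measure lborel K"
  have v: "0 < v" using convex_body_measure_pos[OF K] by (simp add: v_def)
  note mu = measure_uniform_measure_body[OF K, folded v_def]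
  have "full_dimensional ?\<mu>"
    unfolding full_dimensional_def
  proof (intro allI impI)
    fix H :: "'a set" assume "hyperplane H"
    then obtain a b where ab: "a \<noteq> 0" "H = {x. a \<bullet> x = b}" by (auto simp: hyperplane_def)
    have H: "closed H" unfolding ab by (rule closed_hyperplane)
    have "negligible (K \<inter> H)"
      using negligible_hyperplane[of a b] ab by (intro negligible_Int) auto
    then have "emeasure lborel (K \<inter> H) = 0"
      using H unfolding negligible_iff_null_sets by (auto simp: null_sets_def emeasure_completion)
    then show "measure ?\<mu> H < 1"
      using H by (simp add: mu measure_def)
  qed
  moreover have "borel_prob ?\<mu>"
    using prob_space_uniform_measure_body[OF K] by (simp add: borel_prob_def)
  moreover have "(1 - t) * measure ?\<mu> A powr ?p + t * measure ?\<mu> B powr ?p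
      \<le> measure ?\<mu> {(1 - t) *\<^sub>R a + t *\<^sub>R b | a b. a \<in> A \<and> b \<in> B} powr ?p"
    if t: "t \<in> {0..1}" and A: "compact A" and B: "compact B" and pos: "measure ?\<mu> A * measure ?\<mu> B > 0"
    for A B :: "'a set" and t
  proof -
    let ?C = "{(1 - t) *\<^sub>R a + t *\<^sub>R b | a b. a \<in> A \<and> b \<in> B}"
    have posA: "0 < measure ?\<mu> A" and posB: "0 < measure ?\<mu> B"
      using pos by (auto simp: zero_less_mult_iff not_less[symmetric])
    then have ne: "A \<noteq> {}" "B \<noteq> {}" by auto
    show ?thesis
    proof (cases "t = 0 \<or> t = 1")
      case True
      moreover have "{(1 - 0) *\<^sub>R a + 0 *\<^sub>R b | a b. a \<in> A \<and> b \<in> B} = A"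
        "{(1 - 1) *\<^sub>R a + 1 *\<^sub>R b | a b. a \<in> A \<and> b \<in> B} = B"
        using ne by auto
      ultimately show ?thesis by auto
    next
      case False
      then have t: "0 < t" "t < 1" using t by auto
      have C: "compact ?C" by (rule compact_convex_combination[OF A B])
      have bor: "A \<in> sets borel" "B \<in> sets borel" "?C \<in> sets borel"
        using A B C by (auto intro: borel_compact)
      have "(1 - t) * measure lborel (K \<inter> A) powr ?p + t * measure lborel (K \<inter> B) powr ?p
          \<le> measure lborel (K \<inter> ?C) powr ?p"
      proof (rule brunn_minkowski_compact[OF _ _ _ _ t])
        show "0 < measure lborel (K \<inter> A)" "0 < measure lborel (K \<inter> B)"
          using posA posB v by (simp_all add: mu bor zero_less_divide_iff)
        show "(1 - t) *\<^sub>R x + t *\<^sub>R y \<in> K \<inter> ?C" if "x \<in> K \<inter> A" "y \<in> K \<inter> B" for x y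
          using that convexD[OF cK(2), of x y "1 - t" t] t by auto
      qed (use cK A B C in \<open>auto intro: compact_Int\<close>)
      then have "((1 - t) * measure lborel (K \<inter> A) powr ?p + t * measure lborel (K \<inter> B) powr ?p) / v powr ?p
          \<le> measure lborel (K \<inter> ?C) powr ?p / v powr ?p"
        by (rule divide_right_mono) simp
      then show ?thesis
        using v unfolding mu[OF bor(1)] mu[OF bor(2)] mu[OF bor(3)]
        by (simp add: powr_divide add_divide_distrib)
    qed
  qed
  ultimately show ?thesis
    unfolding s_concave_def by blast
qed

lemma measure_support_uniform_measure:
  assumes K: "convex_body K"
  shows "measure_support (uniform_measure lborel K) = K"
proof (intro set_eqI iffI)
  let ?\<mu> = "uniform_measure lborel K"
  have cK: "compact K" "convex K" "interior K \<noteq> {}"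
    using K by (auto simp: convex_body_def)
  have [measurable]: "K \<in> sets borel" using cK by (intro borel_compact)
  fix x
  show "x \<in> K" if x: "x \<in> measure_support ?\<mu>"
  proof (rule ccontr)
    assume "x \<notin> K"
    moreover have "open (- K)" using cK by (simp add: compact_imp_closed open_Compl)
    ultimately have "measure ?\<mu> (- K) > 0"
      using x unfolding measure_support_def by blast
    then show False
      using measure_uniform_measure_body[OF K, of "- K"] by simp
  qed
  show "x \<in> measure_support ?\<mu>" if x: "x \<in> K"
    unfolding measure_support_def
  proof (intro CollectI allI impI)
    fix U assume U: "open U \<and> x \<in> U"
    have "x \<in> closure (interior K)"
      using convex_closure_interior[OF cK(2,3)] x closure_subset by auto
    then have "U \<inter> interior K \<noteq> {}"
      using U by (auto simp: closure_iff_nhds_not_empty)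
    then have "\<not> negligible (U \<inter> interior K)"
      using U by (intro open_not_negligible) auto
    then have "\<not> negligible (K \<inter> U)"
      using negligible_subset[of "K \<inter> U" "U \<inter> interior K"] interior_subset[of K] by blast
    moreover have [measurable]: "U \<in> sets borel" using U by auto
    ultimately have "emeasure lborel (K \<inter> U) \<noteq> 0"
      unfolding negligible_iff_null_sets by (auto simp: null_sets_def emeasure_completion)
    moreover have "emeasure lborel (K \<inter> U) < \<infinity>"
      using emeasure_mono[of "K \<inter> U" K lborel] convex_body_measure_pos(2)[OF K]
      by (auto intro: order_le_less_trans)
    ultimately have "0 < measure lborel (K \<inter> U)"
      unfolding measure_def by (simp add: enn2real_positive_iff zero_less_iff_neq_zero)
    then show "0 < measure ?\<mu> U"
      using measure_uniform_measure_body[OF K, of U] convex_body_measure_pos(1)[OF K] by simp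
  qed
qed

section \<open>The variance of the logarithm of the depth\<close>

theorem theorem1p5:
  shows "(\<forall>(s::real) (\<mu> :: (real ^ 'n) measure) K.
            0 < s \<and> s \<le> 1 / real CARD('n) \<and> s_concave s \<mu> \<and> convex_body K \<and> measure_support \<mu> = K
              \<longrightarrow> log_depth_variance_le \<mu> (pi\<^sup>2 / (6 * s\<^sup>2)))
       \<and> (\<forall>K :: (real ^ 'n) set. convex_body K
              \<longrightarrow> log_depth_variance_le (uniform_measure lborel K) (pi\<^sup>2 / 6 * (real CARD('n))\<^sup>2))"
proof (intro conjI allI impI)
  fix s :: real and \<mu> :: "(real ^ 'n) measure" and K
  assume "0 < s \<and> s \<le> 1 / real CARD('n) \<and> s_concave s \<mu> \<and> convex_body K \<and> measure_support \<mu> = K"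
  then interpret s_concave_on_body s \<mu> K
    by unfold_locales auto
  show "log_depth_variance_le \<mu> (pi\<^sup>2 / (6 * s\<^sup>2))"
    by (rule log_depth_variance_bound)
next
  fix K :: "(real ^ 'n) set"
  assume K: "convex_body K"
  interpret s_concave_on_body "1 / real CARD('n)" "uniform_measure lborel K" K
    using uniform_measure_s_concave[OF K] measure_support_uniform_measure[OF K] K
    by unfold_locales auto
  show "log_depth_variance_le (uniform_measure lborel K) (pi\<^sup>2 / 6 * (real CARD('n))\<^sup>2)"
    using log_depth_variance_bound by (simp add: power_divide)
qed

end
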